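(* Let $\phi=\tilde p/p$ be a rational inner function on $\mathbb{D}^2$ with a singularity at $\tau\in\mathbb{T}^2$. If $\tau$ is a $B^J$ point of $\phi$ (for a positive integer $J$), then $\max\{K_1,K_2\}\ge 2J$, where $K_i$ is the $z_i$-contact order of $\phi$.
   Context: $\phi=\tilde p/p$ where $p\in\mathbb{C}[z_1,z_2]$ has bidegree $(m,n)$, no zeros in $\mathbb{D}^2$, is atoral, and $\tilde p(z)=z_1^mz_2^n\overline{p(1/\bar z_1,1/\bar z_2)}$; a singularity is a zero of $p$ on $\mathbb{T}^2$. Contact orders: for $\zeta_2\in\mathbb{T}$ not the $z_2$-coordinate of a singularity, $\epsilon(\phi,\zeta_2)=\min\{1-|z_1|:\tilde p(z_1,\zeta_2)=0\}$ ($=0$ otherwise); for each $z_2$-coordinate $\tau_2$ of a singularity there is a rational $K>0$ with $\epsilon(\phi,\zeta_2)\approx|\tau_2-\zeta_2|^K$ near $\tau_2$, and $K_1$ is the maximum such $K$; $K_2$ is defined symmetrically. $B^J$ points: let $\Pi$ be the upper half plane, $\tilde\beta(w)=\frac{1+iw}{1-iw}$, and for $\tau=(\tau_1,\tau_2)\in\mathbb{T}^2$ let $g_\tau(w)=i\,\frac{1-\phi(\tau_1\tilde\beta(w_1),\tau_2\tilde\beta(w_2))}{1+\phi(\tau_1\tilde\beta(w_1),\tau_2\tilde\beta(w_2))}$ for $w\in\Pi^2$. Then $\tau$ is a $B^J$ point of $\phi$ if $\lim_{s\to0^+}|g_\tau(is,is)|=0$ and there are real numbers $\{\rho_j\}_{|j|\le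 2J-2}$, $j=(j_1,j_2)\in\mathbb{N}^2$, $|j|=j_1+j_2$, such that $g_\tau(w)=\sum_{|j|\le2J-2}\rho_jw^j+O(\|w\|^{2J-1})$ non-tangentially, meaning: for each $c>0$ this holds for all sufficiently small $w\in\Pi^2$ with $\|1/w\|\le c\min\{-\mathrm{Im}(1/w_1),-\mathrm{Im}(1/w_2)\}$. *)

theory Defs
  imports "HOL-Analysis.Analysis"
begin

definition bipoly :: "(nat \<Rightarrow> nat \<Rightarrow> complex) \<Rightarrow> nat \<Rightarrow> nat \<Rightarrow> complex \<Rightarrow> complex \<Rightarrow> complex" where
  "bipoly c m n z1 z2 = (\<Sum>i\<le>m. \<Sum>j\<le>n. c i j * z1 ^ i * z2 ^ j)"

definition has_bidegree :: "(nat \<Rightarrow> nat \<Rightarrow> complex) \<Rightarrow> nat \<Rightarrow> nat \<Rightarrow> bool" where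
  "has_bidegree c m n \<longleftrightarrow> (\<exists>j\<le>n. c m j \<noteq> 0) \<and> (\<exists>i\<le>m. c i n \<noteq> 0)"

text \<open>The reflection p~(z) = z1^m z2^n conj(p(1/conj z1, 1/conj z2)),
  written out in coefficients (this is the polynomial extension of that formula).\<close>
definition refl_bipoly :: "(nat \<Rightarrow> nat \<Rightarrow> complex) \<Rightarrow> nat \<Rightarrow> nat \<Rightarrow> complex \<Rightarrow> complex \<Rightarrow> complex" where
  "refl_bipoly c m n z1 z2 = (\<Sum>i\<le>m. \<Sum>j\<le>n. cnj (c i j) * z1 ^ (m - i) * z2 ^ (n - j))"

definition is_poly2 :: "(complex \<Rightarrow> complex \<Rightarrow> complex) \<Rightarrow> bool" where
  "is_poly2 f \<longleftrightarrow> (\<exists>N d. \<forall>z w. f z w = (\<Sum>i\<le>N. \<Sum>j\<le>N. d i j * z ^ i * w ^ j))"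

definition atoral :: "(nat \<Rightarrow> nat \<Rightarrow> complex) \<Rightarrow> nat \<Rightarrow> nat \<Rightarrow> bool" where
  "atoral c m n \<longleftrightarrow> \<not> (\<exists>q r s. is_poly2 q \<and> is_poly2 r \<and> is_poly2 s \<and>
       \<not> (\<exists>k. \<forall>z w. q z w = k) \<and>
       (\<forall>z w. bipoly c m n z w = q z w * r z w) \<and>
       (\<forall>z w. refl_bipoly c m n z w = q z w * s z w))"

definition rif :: "(nat \<Rightarrow> nat \<Rightarrow> complex) \<Rightarrow> nat \<Rightarrow> nat \<Rightarrow> complex \<Rightarrow> complex \<Rightarrow> complex" where
  "rif c m n z1 z2 = refl_bipoly c m n z1 z2 / bipoly c m n z1 z2"

definition sing :: "(nat \<Rightarrow> nat \<Rightarrow> complex) \<Rightarrow> nat \<Rightarrow> nat \<Rightarrow> (complex \<times> complex) set" where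
  "sing c m n = {(a, b). cmod a = 1 \<and> cmod b = 1 \<and> bipoly c m n a b = 0}"

definition eps1 :: "(nat \<Rightarrow> nat \<Rightarrow> complex) \<Rightarrow> nat \<Rightarrow> nat \<Rightarrow> complex \<Rightarrow> real" where
  "eps1 c m n \<zeta> = (if \<zeta> \<in> snd ` sing c m n then 0
      else Inf {1 - cmod z1 | z1. refl_bipoly c m n z1 \<zeta> = 0})"

definition eps2 :: "(nat \<Rightarrow> nat \<Rightarrow> complex) \<Rightarrow> nat \<Rightarrow> nat \<Rightarrow> complex \<Rightarrow> real" where
  "eps2 c m n \<zeta> = (if \<zeta> \<in> fst ` sing c m n then 0
      else Inf {1 - cmod z2 | z2. refl_bipoly c m n \<zeta> z2 = 0})"

definition contact_exp :: "(complex \<Rightarrow> real) \<Rightarrow> complex \<Rightarrow> real \<Rightarrow> bool" where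
  "contact_exp e \<tau> K \<longleftrightarrow> K \<in> \<rat> \<and> K > 0 \<and>
     (\<exists>C1>0. \<exists>C2>0. \<exists>\<delta>>0. \<forall>\<zeta>. cmod \<zeta> = 1 \<and> cmod (\<tau> - \<zeta>) < \<delta> \<longrightarrow>
        C1 * cmod (\<tau> - \<zeta>) powr K \<le> e \<zeta> \<and> e \<zeta> \<le> C2 * cmod (\<tau> - \<zeta>) powr K)"

definition K1 :: "(nat \<Rightarrow> nat \<Rightarrow> complex) \<Rightarrow> nat \<Rightarrow> nat \<Rightarrow> real" where
  "K1 c m n = Sup {K. \<exists>\<sigma>\<in>sing c m n. contact_exp (eps1 c m n) (snd \<sigma>) K}"

definition K2 :: "(nat \<Rightarrow> nat \<Rightarrow> complex) \<Rightarrow> nat \<Rightarrow> nat \<Rightarrow> real" where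
  "K2 c m n = Sup {K. \<exists>\<sigma>\<in>sing c m n. contact_exp (eps2 c m n) (fst \<sigma>) K}"

definition cayley :: "complex \<Rightarrow> complex" where
  "cayley w = (1 + \<i> * w) / (1 - \<i> * w)"

definition gfun :: "(complex \<Rightarrow> complex \<Rightarrow> complex) \<Rightarrow> complex \<Rightarrow> complex \<Rightarrow> complex \<Rightarrow> complex \<Rightarrow> complex" where
  "gfun \<phi> \<tau>1 \<tau>2 w1 w2 =
     \<i> * (1 - \<phi> (\<tau>1 * cayley w1) (\<tau>2 * cayley w2)) / (1 + \<phi> (\<tau>1 * cayley w1) (\<tau>2 * cayley w2))"

definition BJ_point :: "(complex \<Rightarrow> complex \<Rightarrow> complex) \<Rightarrow> nat \<Rightarrow> complex \<Rightarrow> complex \<Rightarrow> bool" where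
  "BJ_point \<phi> J \<tau>1 \<tau>2 \<longleftrightarrow>
     ((\<lambda>s. cmod (gfun \<phi> \<tau>1 \<tau>2 (\<i> * of_real s) (\<i> * of_real s))) \<longlongrightarrow> 0) (at_right 0) \<and>
     (\<exists>\<rho> :: nat \<times> nat \<Rightarrow> real.
       \<forall>c>0. \<exists>C \<delta>. \<delta> > 0 \<and> (\<forall>w1 w2. Im w1 > 0 \<and> Im w2 > 0 \<and> norm (w1, w2) < \<delta> \<and>
          norm (1 / w1, 1 / w2) \<le> c * min (- Im (1 / w1)) (- Im (1 / w2)) \<longrightarrow>
          cmod (gfun \<phi> \<tau>1 \<tau>2 w1 w2 -
                (\<Sum>(j1, j2)\<in>{(a, b). a + b \<le> 2 * J - 2}. of_real (\<rho> (j1, j2)) * w1 ^ j1 * w2 ^ j2))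
            \<le> C * norm (w1, w2) ^ (2 * J - 1)))"

end

theory Submission
  imports Defs "HOL-Complex_Analysis.Complex_Analysis"
    "HOL-Computational_Algebra.Computational_Algebra"
    "HOL-Computational_Algebra.Field_as_Ring"
begin

text \<open>
  Write \<open>p~\<close> for the reflection of \<open>p\<close>. For \<open>\<zeta>\<close> on the circle off the singular coordinates,
  \<open>\<phi>(\<cdot>, \<zeta>)\<close> is a Blaschke product of degree \<open>m\<close>, and the derivative \<open>h\<close> of its argument is a sum
  of Poisson kernels. With \<open>\<epsilon> = \<epsilon>(\<phi>, \<zeta>)\<close> one has \<open>h \<le> 2 m / \<epsilon>\<close> everywhere and
  \<open>h \<ge> 1 / (4 \<epsilon>)\<close> at some point where \<open>\<phi>^32 = 1\<close>. Hence \<open>1 / \<epsilon>\<close> is comparable to the sum of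
  \<open>h\<close> over all solutions of \<open>\<phi>^32 = 1\<close>. That sum is symmetric in the roots of \<open>p~^32 - p^32\<close>,
  hence a rational function of \<open>\<zeta>\<close>. So \<open>\<epsilon>\<close> behaves like an integral power of
  \<open>|\<tau>2 - \<zeta>|\<close> from both sides, and no Puiseux expansion is needed.

  In half-plane coordinates \<open>g = Q / P\<close> with polynomials \<open>P\<close>, \<open>Q\<close>. If \<open>P\<close> vanishes to order \<open>M\<close>
  at the origin and \<open>R\<close> is the Taylor polynomial of the \<open>B^J\<close> point, then \<open>Q - R P\<close> vanishes to
  order \<open>M + 2 J - 1\<close>. For fixed real \<open>w2 = x\<close>, integrate \<open>g - R = (Q - R P) / P\<close> over a circle
  \<open>|w1| = \<rho> x\<close>. The integral is \<open>O(x^(2 J))\<close>. All residues have the same sign because \<open>g(\<cdot>, x)\<close>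
  is a Pick function, and they are \<open>-(1 + w1^2) / h\<close>. Thus \<open>1 / h\<close>, and with it \<open>\<epsilon>\<close>, is
  \<open>O(x^(2 J))\<close>. The circle contains a pole unless the lowest homogeneous part of \<open>P\<close> is a power
  of \<open>w2\<close>; in that case the two variables are interchanged.
\<close>

section \<open>Bivariate polynomials and elimination\<close>

text \<open>Iterated polynomials over the factorial ring of polynomials in \<open>w\<close> give
  access to content, prime factors and pseudo-division in the outer variable \<open>z\<close>. The
  outer variable is the first argument throughout.\<close>

definition eval2 :: "complex poly poly \<Rightarrow> complex \<Rightarrow> complex \<Rightarrow> complex" where
  "eval2 F z w = poly (poly F [:z:]) w"

definition slice :: "complex poly poly \<Rightarrow> complex \<Rightarrow> complex poly" where
  "slice F w = map_poly (\<lambda>q. poly q w) F"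

lemma eval2_simps [simp]:
  "eval2 0 z w = 0" "eval2 (pCons a F) z w = poly a w + z * eval2 F z w"
  "eval2 (F + G) z w = eval2 F z w + eval2 G z w"
  "eval2 (F - G) z w = eval2 F z w - eval2 G z w"
  "eval2 (F * G) z w = eval2 F z w * eval2 G z w"
  "eval2 (F ^ k) z w = eval2 F z w ^ k"
  "eval2 (smult a F) z w = poly a w * eval2 F z w"
  "eval2 (sum f S) z w = (\<Sum>i\<in>S. eval2 (f i) z w)"
  "eval2 (monom a k) z w = poly a w * z ^ k"
  by (simp_all add: eval2_def poly_sum poly_monom)

lemma coeff_slice [simp]: "coeff (slice F w) k = poly (coeff F k) w"
  by (simp add: slice_def coeff_map_poly)

lemma poly_slice [simp]: "poly (slice F w) z = eval2 F z w"
  unfolding slice_def by (induction F) (simp_all add: map_poly_pCons)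

lemma pderiv_slice: "pderiv (slice F w) = slice (pderiv F) w"
  by (rule poly_eqI) (simp add: coeff_pderiv)

lemma eval2_inject: "(\<And>z w. eval2 F z w = eval2 G z w) \<Longrightarrow> F = G"
proof -
  assume *: "\<And>z w. eval2 F z w = eval2 G z w"
  have "slice F w = slice G w" for w
    using * by (simp add: poly_eq_poly_eq_iff[symmetric] fun_eq_iff)
  hence "poly (coeff F k) w = poly (coeff G k) w" for k w
    by (metis coeff_slice)
  thus "F = G"
    by (intro poly_eqI[of F G]) (simp add: poly_eq_poly_eq_iff[symmetric] fun_eq_iff)
qed

lemma poly_eq_sum_upto:
  fixes p :: "'a :: comm_semiring_1 poly"
  assumes "degree p \<le> N"
  shows "poly p x = (\<Sum>i\<le>N. coeff p i * x ^ i)"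
  unfolding poly_altdef by (intro sum.mono_neutral_left) (use assms in \<open>auto simp: coeff_eq_0\<close>)

lemma is_poly2_iff: "is_poly2 f \<longleftrightarrow> (\<exists>F. f = eval2 F)"
proof
  assume "is_poly2 f"
  then obtain N d where "\<forall>z w. f z w = (\<Sum>i\<le>N. \<Sum>j\<le>N. d i j * z ^ i * w ^ j)"
    unfolding is_poly2_def by blast
  hence "f = eval2 (\<Sum>i\<le>N. \<Sum>j\<le>N. monom (monom (d i j) j) i)"
    by (auto simp: fun_eq_iff poly_monom mult_ac)
  thus "\<exists>F. f = eval2 F" by blast
next
  assume "\<exists>F. f = eval2 F"
  then obtain F where f: "f = eval2 F" by blast
  define N where "N = Max (insert (degree F) ((\<lambda>i. degree (coeff F i)) ` {..degree F}))"
  have N1: "degree F \<le> N" unfolding N_def by simp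
  have N2: "degree (coeff F i) \<le> N" for i
  proof (cases "i \<le> degree F")
    case True thus ?thesis unfolding N_def by (intro Max_ge) auto
  next
    case False thus ?thesis by (simp add: coeff_eq_0)
  qed
  have "f z w = (\<Sum>i\<le>N. \<Sum>j\<le>N. coeff (coeff F i) j * z ^ i * w ^ j)" for z w
  proof -
    have "degree (slice F w) \<le> N"
      by (intro degree_le) (use N1 in \<open>auto simp: coeff_eq_0\<close>)
    hence "f z w = (\<Sum>i\<le>N. poly (coeff F i) w * z ^ i)"
      using poly_eq_sum_upto[of "slice F w" N z] by (simp add: f)
    also have "\<dots> = (\<Sum>i\<le>N. (\<Sum>j\<le>N. coeff (coeff F i) j * w ^ j) * z ^ i)"
      using poly_eq_sum_upto[OF N2] by simp
    finally show ?thesis by (simp add: sum_distrib_left sum_distrib_right mult_ac)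
  qed
  thus "is_poly2 f" unfolding is_poly2_def
    by (intro exI[of _ N] exI[of _ "\<lambda>i j. coeff (coeff F i) j"]) blast
qed

text \<open>A constant prime factor of the primitive part would divide its content, which is a unit.
  So every prime factor of the primitive part has positive degree.\<close>

lemma prime_factor_of_positive_degree:
  fixes d :: "'a :: {factorial_ring_gcd, semiring_gcd_mult_normalize} poly"
  assumes "degree d > 0"
  obtains f where "prime_elem f" "f dvd d" "degree f > 0"
proof -
  define e where "e = primitive_part d"
  have "d \<noteq> 0" using assms by auto
  have "degree e > 0" using assms by (simp add: e_def)
  hence "\<not> is_unit e" "e \<noteq> 0" by (auto simp: is_unit_poly_iff)
  then obtain f where f: "prime f" "f dvd e" using prime_divisor_exists by blast
  have "degree f > 0"
  proof (rule ccontr)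
    assume "\<not> degree f > 0"
    then obtain a where a: "f = [:a:]" by (meson degree_eq_zeroE neq0_conv)
    have "a dvd content e"
      using f(2) unfolding a by (simp add: const_poly_dvd_iff_dvd_content)
    hence "is_unit a" using \<open>d \<noteq> 0\<close> by (simp add: e_def)
    thus False using f(1) unfolding a by (simp add: prime_def prime_elem_def is_unit_const_poly_iff)
  qed
  moreover have "f dvd d"
    using f(2) unfolding e_def by (metis content_times_primitive_part dvd_smult)
  ultimately show ?thesis using f(1) that by (auto simp: prime_def)
qed

text \<open>This plays the role of a resultant. By pseudo-division, an element of least degree in
  the ideal of \<open>F\<close> and \<open>G\<close> divides every element up to a nonzero factor
  from the coefficient ring. If its degree were positive, one of its prime factors would be common
  to \<open>F\<close> and \<open>G\<close>.\<close>

lemma elimination: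
  fixes F G :: "'a :: {factorial_ring_gcd, semiring_gcd_mult_normalize} poly"
  assumes "F \<noteq> 0" and no_common: "\<And>f. prime_elem f \<Longrightarrow> degree f > 0 \<Longrightarrow> f dvd F \<Longrightarrow> f dvd G \<Longrightarrow> False"
  obtains A B r where "A * F + B * G = [:r:]" "r \<noteq> 0"
proof -
  define I where "I = {X. \<exists>A B. X = A * F + B * G}"
  have I_diff: "X - Y \<in> I" if "X \<in> I" "Y \<in> I" for X Y
  proof -
    from that obtain A B A' B' where "X = A * F + B * G" "Y = A' * F + B' * G"
      unfolding I_def by blast
    hence "X - Y = (A - A') * F + (B - B') * G" by (simp add: algebra_simps)
    thus ?thesis unfolding I_def by blast
  qed
  have I_mult: "Z * X \<in> I" if "X \<in> I" for X Z
  proof -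
    from that obtain A B where "X = A * F + B * G" unfolding I_def by blast
    hence "Z * X = (Z * A) * F + (Z * B) * G" by (simp add: algebra_simps)
    thus ?thesis unfolding I_def by blast
  qed
  have "F = 1 * F + 0 * G" "G = 0 * F + 1 * G" by simp_all
  hence FI: "F \<in> I" and GI: "G \<in> I" unfolding I_def by blast+
  have "\<exists>d. (d \<in> I \<and> d \<noteq> 0) \<and> (\<forall>y. y \<in> I \<and> y \<noteq> 0 \<longrightarrow> degree d \<le> degree y)"
    using ex_has_least_nat[of "\<lambda>d. d \<in> I \<and> d \<noteq> 0" F degree] FI \<open>F \<noteq> 0\<close> by blast
  then obtain d where d: "d \<in> I" "d \<noteq> 0" and d_min: "\<And>y. y \<in> I \<Longrightarrow> y \<noteq> 0 \<Longrightarrow> degree d \<le> degree y"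
    by blast
  have dvd: "\<exists>a. a \<noteq> 0 \<and> d dvd smult a X" if "X \<in> I" for X
  proof -
    obtain a q where aq: "a \<noteq> 0" "smult a X = d * q + pseudo_mod X d"
      "pseudo_mod X d = 0 \<or> degree (pseudo_mod X d) < degree d"
      using pseudo_mod[of d X] d(2) by auto
    have "pseudo_mod X d = [:a:] * X - q * d" using aq(2) by (simp add: algebra_simps)
    hence "pseudo_mod X d \<in> I" using I_diff I_mult that d(1) by metis
    hence "pseudo_mod X d = 0" using d_min aq(3) by force
    thus ?thesis using aq by auto
  qed
  have "degree d = 0"
  proof (rule ccontr)
    assume "degree d \<noteq> 0"
    then obtain f where f: "prime_elem f" "f dvd d" "degree f > 0"
      using prime_factor_of_positive_degree by blast
    have "f dvd X" if "X \<in> I" for X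
    proof -
      obtain a where a: "a \<noteq> 0" "d dvd smult a X" using dvd \<open>X \<in> I\<close> by blast
      hence "f dvd [:a:] * X" using f(2) by auto
      moreover have "\<not> f dvd [:a:]"
        using divides_degree[of f "[:a:]"] f(3) a(1) by auto
      ultimately show ?thesis using f(1) prime_elem_dvd_mult_iff by blast
    qed
    thus False using no_common[OF f(1,3)] FI GI by blast
  qed
  then obtain r where "d = [:r:]" by (meson degree_eq_zeroE)
  moreover obtain A B where "d = A * F + B * G" using d(1) unfolding I_def by blast
  ultimately show ?thesis using d(2) that[of A B r] by simp
qed

section \<open>Sums over the roots of a polynomial\<close>

lemma sum_roots_div_pderiv:
  fixes D f :: "complex poly"
  assumes D: "rsquarefree D" and deg: "degree f < degree D"
  shows "(\<Sum>\<alpha> | poly D \<alpha> = 0. poly f \<alpha> / poly (pderiv D) \<alpha>) = coeff f (degree D - 1) / lead_coeff D"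
proof -
  define S where "S = {\<alpha>. poly D \<alpha> = 0}"
  have "D \<noteq> 0" using deg by auto
  have fin: "finite S" unfolding S_def using poly_roots_finite[OF \<open>D \<noteq> 0\<close>] .
  define l where "l = lead_coeff D"
  have l0: "l \<noteq> 0" using \<open>D \<noteq> 0\<close> by (simp add: l_def)
  have Dprod: "D = smult l (\<Prod>z\<in>S. [:-z, 1:])"
    using complex_poly_decompose_rsquarefree[OF D] by (simp add: S_def l_def)
  have degprod: "degree (\<Prod>z\<in>T. [:-z, 1:]) = card T" for T :: "complex set"
    by (subst degree_prod_eq_sum_degree) auto
  have cardS: "card S = degree D" using Dprod degprod l0 by (metis degree_smult_eq)
  define E where "E = (\<lambda>\<alpha>. smult l (\<Prod>z\<in>S - {\<alpha>}. [:-z, 1:]))"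
  have DE: "D = [:-\<alpha>, 1:] * E \<alpha>" if "\<alpha> \<in> S" for \<alpha>
    unfolding E_def by (subst Dprod, subst prod.remove[OF fin that]) simp
  have E_other: "poly (E \<alpha>) \<beta> = 0" if "\<alpha> \<in> S" "\<beta> \<in> S" "\<alpha> \<noteq> \<beta>" for \<alpha> \<beta>
    unfolding E_def using that fin by (auto simp: poly_prod)
  have E_self: "poly (E \<alpha>) \<alpha> = poly (pderiv D) \<alpha>" if "\<alpha> \<in> S" for \<alpha>
    by (subst DE[OF that]) (simp add: pderiv_mult pderiv_pCons del: mult_pCons_left)
  have D'0: "poly (pderiv D) \<alpha> \<noteq> 0" if "\<alpha> \<in> S" for \<alpha>
    using D that by (auto simp: rsquarefree_roots S_def)
  \<comment> \<open>The Lagrange interpolation polynomial of \<open>f\<close> at the roots of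
    \<open>D\<close>; \<open>E \<alpha>\<close> is \<open>D\<close> without the linear factor of
    \<open>\<alpha>\<close>. It equals \<open>f\<close> because both have degree below the number of
    roots, and the claim compares the coefficients of degree \<open>degree D - 1\<close>.\<close>
  define L where "L = (\<Sum>\<alpha>\<in>S. smult (poly f \<alpha> / poly (pderiv D) \<alpha>) (E \<alpha>))"
  have degE: "degree (E \<alpha>) = degree D - 1" if "\<alpha> \<in> S" for \<alpha>
    unfolding E_def using that l0 degprod cardS fin by simp
  have leadE: "coeff (E \<alpha>) (degree D - 1) = l" if "\<alpha> \<in> S" for \<alpha>
  proof -
    have "lead_coeff (E \<alpha>) = l"
      unfolding E_def by (simp add: lead_coeff_smult lead_coeff_prod)
    thus ?thesis using degE[OF that] by simp
  qed
  have "L = f"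
  proof (rule ccontr)
    assume "L \<noteq> f"
    hence ne: "L - f \<noteq> 0" by simp
    have "S \<subseteq> {x. poly (L - f) x = 0}"
    proof
      fix \<beta> assume "\<beta> \<in> S"
      have "poly L \<beta> = (\<Sum>\<alpha>\<in>S. if \<alpha> = \<beta> then poly f \<beta> else 0)"
        unfolding L_def poly_sum
        by (intro sum.cong) (use \<open>\<beta> \<in> S\<close> E_other E_self D'0 in auto)
      thus "\<beta> \<in> {x. poly (L - f) x = 0}" using \<open>\<beta> \<in> S\<close> fin by simp
    qed
    hence "card S \<le> card {x. poly (L - f) x = 0}"
      by (intro card_mono poly_roots_finite ne)
    also have "\<dots> \<le> degree (L - f)" by (rule card_poly_roots_bound[OF ne])
    also have "\<dots> \<le> degree D - 1"
    proof (rule degree_diff_le)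
      show "degree L \<le> degree D - 1" unfolding L_def
        by (intro degree_sum_le fin) (metis degE degree_smult_le)
    qed (use deg in simp)
    finally show False using cardS deg by simp
  qed
  hence "coeff f (degree D - 1) = coeff L (degree D - 1)" by simp
  also have "\<dots> = (\<Sum>\<alpha>\<in>S. poly f \<alpha> / poly (pderiv D) \<alpha> * l)"
    unfolding L_def coeff_sum by (intro sum.cong refl) (use leadE in simp)
  also have "\<dots> = (\<Sum>\<alpha>\<in>S. poly f \<alpha> / poly (pderiv D) \<alpha>) * l" by (simp only: sum_distrib_right)
  finally have "coeff f (degree D - 1) = (\<Sum>\<alpha>\<in>S. poly f \<alpha> / poly (pderiv D) \<alpha>) * l" .
  thus ?thesis using l0 by (simp add: S_def[symmetric] l_def[symmetric])
qed

text \<open>A numerator \<open>W\<close> of any degree is first reduced modulo \<open>D\<close> by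
  pseudo-division. The multiplier \<open>a\<close> of that division and the leading coefficient of
  \<open>D\<close> make up the denominator \<open>L\<close>, so the sum is a rational function of
  \<open>w\<close>.\<close>

lemma sum_roots_rational:
  fixes D W :: "complex poly poly"
  assumes "degree D > 0"
  obtains L Num :: "complex poly" where "L \<noteq> 0"
    "\<And>w. poly (lead_coeff D) w \<noteq> 0 \<Longrightarrow> rsquarefree (slice D w) \<Longrightarrow>
       (\<Sum>\<alpha> | eval2 D \<alpha> w = 0. eval2 W \<alpha> w / eval2 (pderiv D) \<alpha> w) * poly L w = poly Num w"
proof -
  have "D \<noteq> 0" using assms by auto
  then obtain a q where aq: "a \<noteq> 0" "smult a W = D * q + pseudo_mod W D"
    "pseudo_mod W D = 0 \<or> degree (pseudo_mod W D) < degree D"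
    using pseudo_mod[of D W] by auto
  define r where "r = pseudo_mod W D"
  have degr: "degree r < degree D" using aq(3) assms unfolding r_def by auto
  show ?thesis
  proof (rule that[of "a * lead_coeff D" "coeff r (degree D - 1)"])
    show "a * lead_coeff D \<noteq> 0" using aq(1) \<open>D \<noteq> 0\<close> by simp
    fix w assume lead: "poly (lead_coeff D) w \<noteq> 0" and sq: "rsquarefree (slice D w)"
    have degD: "degree (slice D w) = degree D"
      by (intro antisym degree_le le_degree) (use lead in \<open>auto simp: coeff_eq_0\<close>)
    have "degree (slice r w) \<le> degree r"
      by (intro degree_le) (auto simp: coeff_eq_0)
    hence E: "(\<Sum>\<alpha> | eval2 D \<alpha> w = 0. eval2 r \<alpha> w / eval2 (pderiv D) \<alpha> w)
        = poly (coeff r (degree D - 1)) w / poly (lead_coeff D) w"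
      using sum_roots_div_pderiv[OF sq, of "slice r w"] degr by (simp add: degD pderiv_slice)
    have "poly a w * eval2 W \<alpha> w = eval2 r \<alpha> w" if "eval2 D \<alpha> w = 0" for \<alpha>
    proof -
      have "eval2 (smult a W) \<alpha> w = eval2 (D * q + r) \<alpha> w" using aq(2) by (simp add: r_def)
      thus ?thesis using that by simp
    qed
    hence "(\<Sum>\<alpha> | eval2 D \<alpha> w = 0. eval2 W \<alpha> w / eval2 (pderiv D) \<alpha> w) * poly a w
        = (\<Sum>\<alpha> | eval2 D \<alpha> w = 0. eval2 r \<alpha> w / eval2 (pderiv D) \<alpha> w)"
      unfolding sum_distrib_right by (intro sum.cong refl) (simp add: mult.commute)
    thus "(\<Sum>\<alpha> | eval2 D \<alpha> w = 0. eval2 W \<alpha> w / eval2 (pderiv D) \<alpha> w) * poly (a * lead_coeff D) w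
        = poly (coeff r (degree D - 1)) w"
      using E lead by (simp add: mult.assoc[symmetric])
  qed
qed

section \<open>Finite Blaschke products\<close>

lemma poly_pderiv_prod:
  fixes f :: "'b \<Rightarrow> 'a :: field_char_0 poly"
  assumes "finite A" "\<And>k. k \<in> A \<Longrightarrow> poly (f k) z \<noteq> 0"
  shows "poly (pderiv (\<Prod>k\<in>A. f k)) z
           = poly (\<Prod>k\<in>A. f k) z * (\<Sum>k\<in>A. poly (pderiv (f k)) z / poly (f k) z)"
  using assms by (induction A rule: finite_induct) (auto simp: pderiv_mult field_simps)

lemma norm_diff_cis_le: "cmod (cis s - cis t) \<le> \<bar>s - t\<bar>"
proof -
  have "cis s - cis t = cis t * (exp (\<i> * of_real (s - t)) - 1)"
    by (simp add: cis_conv_exp exp_diff right_diff_distrib field_simps)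
  hence "cmod (cis s - cis t) = 2 * \<bar>sin ((s - t) / 2)\<bar>"
    using dist_exp_i_1[of "s - t"] by (simp add: norm_mult)
  also have "\<dots> \<le> \<bar>s - t\<bar>"
    using abs_sin_x_le_abs_x[of "(s - t) / 2"] by simp
  finally show ?thesis .
qed

lemma cmod_mobius_identity:
  "(cmod (z - a))\<^sup>2 - (cmod (1 - cnj a * z))\<^sup>2 = ((cmod z)\<^sup>2 - 1) * (1 - (cmod a)\<^sup>2)"
  by (simp only: cmod_power2) (simp add: power2_eq_square algebra_simps)

text \<open>On the circle \<open>1 - cnj b * z\<close> equals \<open>z * cnj (z - b)\<close>. This
  turns \<open>z\<close> times the logarithmic derivative of one Blaschke factor into the Poisson
  kernel of \<open>b\<close>.\<close>

lemma poisson_term: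
  assumes z: "cmod z = 1" and b: "cmod b < 1"
  shows "z / (z - b) + cnj b * z / (1 - cnj b * z) = of_real ((1 - (cmod b)\<^sup>2) / (cmod (z - b))\<^sup>2)"
proof -
  have zz: "z * cnj z = 1" using z by (simp add: complex_norm_square[symmetric])
  have n1: "z - b \<noteq> 0" using z b by auto
  have e: "1 - cnj b * z = z * cnj (z - b)" using zz by (simp add: algebra_simps)
  have n2: "z \<noteq> 0" using z by auto
  have "z / (z - b) + cnj b * z / (1 - cnj b * z) = z / (z - b) + cnj b / cnj (z - b)"
    unfolding e using n2 by (simp add: mult.commute)
  also have "\<dots> = (z * cnj (z - b) + cnj b * (z - b)) / ((z - b) * cnj (z - b))"
    using n1 by (simp add: add_frac_eq)
  also have "z * cnj (z - b) + cnj b * (z - b) = of_real (1 - (cmod b)\<^sup>2)"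
    using zz complex_norm_square[of b] by (simp add: algebra_simps)
  finally show ?thesis using complex_norm_square[of "z - b"] by simp
qed

text \<open>The quotient \<open>num / den\<close> is a finite Blaschke product with zeros
  \<open>a k\<close>, repeated by multiplicity. Two constants of equal modulus are carried along so
  that \<open>num\<close> and \<open>den\<close> can be the slices of \<open>p~\<close> and
  \<open>p\<close> themselves and not just multiples of them.\<close>

locale blaschke =
  fixes m :: nat and a :: "nat \<Rightarrow> complex" and C C' :: complex
  assumes m: "m > 0" and a: "\<And>k. k < m \<Longrightarrow> cmod (a k) < 1"
    and C: "C \<noteq> 0" and C': "cmod C' = cmod C"
begin

definition num :: "complex poly" where "num = smult C (\<Prod>k<m. [:- a k, 1:])"

definition den :: "complex poly" where "den = smult C' (\<Prod>k<m. [:1, - cnj (a k):])"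

definition poisson :: "complex \<Rightarrow> real" where
  "poisson z = (\<Sum>k<m. (1 - (cmod (a k))\<^sup>2) / (cmod (z - a k))\<^sup>2)"

lemma poly_num: "poly num z = C * (\<Prod>k<m. z - a k)"
  by (simp add: num_def poly_prod)

lemma poly_den: "poly den z = C' * (\<Prod>k<m. 1 - cnj (a k) * z)"
  by (simp add: den_def poly_prod mult.commute)

lemma one_minus_cmod_sq_pos: "k < m \<Longrightarrow> 1 - (cmod (a k))\<^sup>2 > 0"
  using a[of k] by (simp add: abs_square_less_1)

text \<open>All three cases follow factor by factor from \<open>cmod_mobius_identity\<close>. The
  trichotomy forces the solutions of \<open>num ^ N = den ^ N\<close> with \<open>N > 0\<close>, and
  those of \<open>num = - den\<close>, onto the unit circle.\<close>

lemma cmod_num_den: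
  "cmod z < 1 \<Longrightarrow> cmod (poly num z) < cmod (poly den z)"
  "cmod z = 1 \<Longrightarrow> cmod (poly num z) = cmod (poly den z)"
  "cmod z > 1 \<Longrightarrow> cmod (poly num z) > cmod (poly den z)"
proof -
  have C0: "cmod C > 0" "C' \<noteq> 0" using C C' by auto
  have E: "cmod (poly num z) = cmod C * (\<Prod>k<m. cmod (z - a k))"
     "cmod (poly den z) = cmod C * (\<Prod>k<m. cmod (1 - cnj (a k) * z))"
    by (simp_all add: poly_num poly_den norm_mult prod_norm C')
  show "cmod (poly num z) < cmod (poly den z)" if "cmod z < 1"
  proof -
    have "cmod (z - a k) < cmod (1 - cnj (a k) * z)" if "k < m" for k
    proof -
      have "((cmod z)\<^sup>2 - 1) * (1 - (cmod (a k))\<^sup>2) < 0"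
        using \<open>cmod z < 1\<close> one_minus_cmod_sq_pos[OF that]
        by (intro mult_neg_pos) (auto simp: abs_square_less_1)
      hence "(cmod (z - a k))\<^sup>2 < (cmod (1 - cnj (a k) * z))\<^sup>2"
        using cmod_mobius_identity[of z "a k"] by linarith
      thus ?thesis by (rule power2_less_imp_less) simp
    qed
    moreover from this have "cnj (a k) * z \<noteq> 1" if "k < m" for k
      using that by fastforce
    ultimately have "(\<Prod>k<m. cmod (z - a k)) < (\<Prod>k<m. cmod (1 - cnj (a k) * z))"
      using m by (intro prod_mono_strict) (auto intro: less_imp_le)
    thus ?thesis using E C0 by simp
  qed
  show "cmod (poly num z) > cmod (poly den z)" if "cmod z > 1"
  proof -
    have "cmod (z - a k) > cmod (1 - cnj (a k) * z)" if "k < m" for k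
    proof -
      have "((cmod z)\<^sup>2 - 1) * (1 - (cmod (a k))\<^sup>2) > 0"
        using \<open>cmod z > 1\<close> one_minus_cmod_sq_pos[OF that]
        by (intro mult_pos_pos) auto
      hence "(cmod (z - a k))\<^sup>2 > (cmod (1 - cnj (a k) * z))\<^sup>2"
        using cmod_mobius_identity[of z "a k"] by linarith
      thus ?thesis by (rule power2_less_imp_less) simp
    qed
    moreover from this have "z \<noteq> a k" if "k < m" for k
      using that by fastforce
    ultimately have "(\<Prod>k<m. cmod (z - a k)) > (\<Prod>k<m. cmod (1 - cnj (a k) * z))"
      using m by (intro prod_mono_strict) (auto intro: less_imp_le)
    thus ?thesis using E C0 by simp
  qed
  show "cmod (poly num z) = cmod (poly den z)" if "cmod z = 1"
  proof -
    have "cmod (z - a k) = cmod (1 - cnj (a k) * z)" for k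
      using cmod_mobius_identity[of z "a k"] that by simp
    thus ?thesis using E by simp
  qed
qed

lemma num_nonzero: "cmod z \<ge> 1 \<Longrightarrow> poly num z \<noteq> 0"
  using C a by (force simp: poly_num)

lemma den_nonzero: "cmod z \<le> 1 \<Longrightarrow> poly den z \<noteq> 0"
  using cmod_num_den(1,2)[of z] num_nonzero[of z]
  by (cases "cmod z" "1::real" rule: linorder_cases) fastforce+

lemma unimodular_if_equal_cmod: "cmod (poly num z) = cmod (poly den z) \<Longrightarrow> cmod z = 1"
  using cmod_num_den[of z] by (cases "cmod z" "1::real" rule: linorder_cases) auto

text \<open>Along \<open>z = cis t\<close> the left side is the speed of the argument of the
  Blaschke product, the \<open>h\<close> of the introduction. The formula adds up
  \<open>poisson_term\<close> over the factors.\<close>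

lemma log_derivative:
  assumes z: "cmod z = 1"
  shows "z * (poly (pderiv num) z / poly num z - poly (pderiv den) z / poly den z) = of_real (poisson z)"
proof -
  have zk: "z - a k \<noteq> 0" "1 - cnj (a k) * z \<noteq> 0" if "k < m" for k
  proof -
    show 1: "z - a k \<noteq> 0" using z a[OF that] by auto
    show "1 - cnj (a k) * z \<noteq> 0"
      using cmod_mobius_identity[of z "a k"] z 1 by auto
  qed
  have N: "poly (pderiv num) z / poly num z = (\<Sum>k<m. 1 / (z - a k))"
  proof -
    have "poly (pderiv num) z = poly num z * (\<Sum>k<m. 1 / (z - a k))"
      unfolding num_def pderiv_smult poly_smult
      by (subst poly_pderiv_prod) (use zk in \<open>auto simp: pderiv_pCons\<close>)
    thus ?thesis using num_nonzero[of z] z by simp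
  qed
  have D: "poly (pderiv den) z / poly den z = (\<Sum>k<m. - cnj (a k) / (1 - cnj (a k) * z))"
  proof -
    have "poly (pderiv den) z = poly den z * (\<Sum>k<m. - cnj (a k) / (1 - cnj (a k) * z))"
      unfolding den_def pderiv_smult poly_smult
      by (subst poly_pderiv_prod) (use zk in \<open>auto simp: pderiv_pCons mult.commute\<close>)
    thus ?thesis using den_nonzero[of z] z by simp
  qed
  have "z * (poly (pderiv num) z / poly num z - poly (pderiv den) z / poly den z)
     = (\<Sum>k<m. z / (z - a k) + cnj (a k) * z / (1 - cnj (a k) * z))"
    unfolding N D sum_subtractf[symmetric] sum_distrib_left
    by (intro sum.cong refl) (simp add: distrib_left mult.commute)
  also have "\<dots> = of_real (poisson z)"
    unfolding poisson_def of_real_sum using poisson_term[OF z a] by simp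
  finally show ?thesis .
qed

lemma poisson_pos: "cmod z = 1 \<Longrightarrow> poisson z > 0"
  unfolding poisson_def using m one_minus_cmod_sq_pos a
  by (intro sum_pos) (auto intro!: divide_pos_pos simp: lessThan_empty_iff, fastforce)

text \<open>The distance of \<open>z\<close> from \<open>a k\<close> is at least
  \<open>1 - r\<close> with \<open>r = cmod (a k)\<close>, so one kernel is at most
  \<open>(1 + r) / (1 - r)\<close>, hence at most \<open>2 / e\<close>.\<close>

lemma poisson_le:
  assumes z: "cmod z = 1" and e: "e > 0" "\<And>k. k < m \<Longrightarrow> e \<le> 1 - cmod (a k)"
  shows "poisson z \<le> 2 * real m / e"
proof -
  have "(1 - (cmod (a k))\<^sup>2) / (cmod (z - a k))\<^sup>2 \<le> 2 / e" if k: "k < m" for k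
  proof -
    let ?r = "cmod (a k)"
    have r: "e \<le> 1 - ?r" "?r < 1" using e k a by auto
    have sq: "1 - ?r\<^sup>2 = (1 + ?r) * (1 - ?r)" by (simp add: power2_eq_square algebra_simps)
    have "1 - ?r \<le> cmod (z - a k)" using norm_triangle_ineq2[of z "a k"] z by simp
    hence "(1 - ?r\<^sup>2) / (cmod (z - a k))\<^sup>2 \<le> (1 - ?r\<^sup>2) / (1 - ?r)\<^sup>2"
      using r one_minus_cmod_sq_pos[OF k] by (intro divide_left_mono mult_pos_pos power_mono zero_less_power) auto
    also have "\<dots> = (1 + ?r) / (1 - ?r)"
      unfolding sq using r by (simp add: power2_eq_square)
    also have "\<dots> \<le> 2 / e" using r e by (intro frac_le) auto
    finally show ?thesis .
  qed
  hence "poisson z \<le> (\<Sum>k<m. 2 / e)" unfolding poisson_def by (intro sum_mono) auto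
  thus ?thesis by (simp add: mult.commute)
qed

text \<open>The argument of the Blaschke product grows by at least \<open>1/4\<close> along the arc of length
  \<open>1 - cmod (a k)\<close> starting at the radial projection of \<open>a k\<close>, so its \<open>N\<close>-th power takes the
  value \<open>1\<close> there as soon as \<open>N / 4\<close> exceeds \<open>2 * pi\<close>.\<close>

lemma exists_large_poisson:
  assumes k: "k < m" and N: "N \<ge> 32"
  shows "\<exists>z. cmod z = 1 \<and> poly num z ^ N = poly den z ^ N \<and> poisson z \<ge> 1 / (4 * (1 - cmod (a k)))"
proof (rule ccontr)
  assume no: "\<not> ?thesis"
  define e where "e = 1 - cmod (a k)"
  have e: "e > 0" using a[OF k] by (simp add: e_def)
  define t0 where "t0 = Arg (a k)"
  have ak: "a k = of_real (cmod (a k)) * cis t0"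
    unfolding t0_def by (metis Arg_eq cis_conv_exp mult.commute of_real_0 norm_zero mult_zero_left)
  have large: "poisson (cis t) \<ge> 1 / (4 * e)" if t: "t0 \<le> t" "t \<le> t0 + e" for t
  proof -
    have "cis t - a k = (cis t - cis t0) + of_real e * cis t0"
      by (subst ak) (simp add: e_def algebra_simps)
    hence "cmod (cis t - a k) \<le> cmod (cis t - cis t0) + cmod (of_real e * cis t0)"
      using norm_triangle_ineq by metis
    also have "\<dots> \<le> 2 * e" using norm_diff_cis_le[of t t0] t e by (simp add: norm_mult)
    finally have d: "cmod (cis t - a k) \<le> 2 * e" .
    have "cis t \<noteq> a k" using a[OF k] norm_cis[of t] by (metis less_irrefl)
    hence d0: "cmod (cis t - a k) > 0" by simp
    have "1 / (4 * e) = e / (2 * e)\<^sup>2" using e by (simp add: power2_eq_square)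
    also have "\<dots> \<le> (1 - (cmod (a k))\<^sup>2) / (cmod (cis t - a k))\<^sup>2"
    proof (intro frac_le power_mono)
      show "e \<le> 1 - (cmod (a k))\<^sup>2"
        using mult_left_le[of "cmod (a k)" "cmod (a k)"] a[OF k] by (simp add: e_def power2_eq_square)
    qed (use d d0 one_minus_cmod_sq_pos[OF k] in auto)
    also have "\<dots> \<le> poisson (cis t)"
      unfolding poisson_def using k one_minus_cmod_sq_pos
      by (intro member_le_sum) (auto intro!: divide_nonneg_nonneg simp: less_imp_le)
    finally show ?thesis .
  qed
  \<comment> \<open>On the circle the \<open>N\<close>-th power is unimodular, so its negative meets
    the cut of \<open>Ln\<close> only where the power equals 1. By assumption this does not happen
    on the arc, and \<open>V\<close> is differentiable there.\<close>
  define V where "V = (\<lambda>z. Ln (- ((poly num z / poly den z) ^ N)))"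
  have der: "((\<lambda>t. Im (V (cis t))) has_real_derivative (real N * poisson (cis t))) (at t)"
    if t: "t0 \<le> t" "t \<le> t0 + e" for t
  proof -
    let ?z = "cis t"
    let ?U = "(poly num ?z / poly den ?z) ^ N"
    have nz: "poly num ?z \<noteq> 0" "poly den ?z \<noteq> 0"
      using num_nonzero[of ?z] den_nonzero[of ?z] by auto
    have U1: "cmod ?U = 1" using cmod_num_den(2)[of ?z] nz by (simp add: norm_power norm_divide)
    have "?U \<noteq> 1"
      using no large[OF t] nz unfolding e_def by (auto simp: power_divide)
    have notin: "- ?U \<notin> \<real>\<^sub>\<le>\<^sub>0"
    proof
      assume "- ?U \<in> \<real>\<^sub>\<le>\<^sub>0"
      hence "?U \<in> \<real>\<^sub>\<ge>\<^sub>0" by simp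
      then obtain x where x: "?U = of_real x" "x \<ge> 0" by (auto elim: nonneg_Reals_cases)
      hence "x = 1" using U1 by simp
      hence "?U = 1" using x by simp
      thus False using \<open>?U \<noteq> 1\<close> by simp
    qed
    have U0: "?U \<noteq> 0" using nz by simp
    have dV: "(V has_field_derivative
        (of_nat N * (poly (pderiv num) ?z / poly num ?z - poly (pderiv den) ?z / poly den ?z))) (at ?z)"
    proof -
      have q: "((\<lambda>z. poly num z / poly den z) has_field_derivative
         ((poly (pderiv num) ?z * poly den ?z - poly num ?z * poly (pderiv den) ?z) / (poly den ?z * poly den ?z))) (at ?z)"
        by (intro DERIV_divide poly_DERIV nz)
      define q' where "q' = (poly (pderiv num) ?z * poly den ?z - poly num ?z * poly (pderiv den) ?z) / (poly den ?z * poly den ?z)"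
      have "((\<lambda>z. - ((poly num z / poly den z) ^ N)) has_field_derivative
          - (of_nat N * (q' * (poly num ?z / poly den ?z) ^ (N - Suc 0)))) (at ?z)"
        by (intro DERIV_minus DERIV_power q[folded q'_def])
      hence "(V has_field_derivative
           (inverse (- ?U) * - (of_nat N * (q' * (poly num ?z / poly den ?z) ^ (N - Suc 0))))) (at ?z)"
        unfolding V_def by (intro DERIV_chain2[OF has_field_derivative_Ln]) (use notin in auto)
      moreover have "inverse (- ?U) * - (of_nat N * (q' * (poly num ?z / poly den ?z) ^ (N - Suc 0)))
        = of_nat N * (poly (pderiv num) ?z / poly num ?z - poly (pderiv den) ?z / poly den ?z)"
      proof -
        have "N = Suc (N - Suc 0)" using N by simp
        hence "?U = (poly num ?z / poly den ?z) * (poly num ?z / poly den ?z) ^ (N - Suc 0)"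
          by (metis power_Suc)
        hence "inverse (- ?U) * - (of_nat N * (q' * (poly num ?z / poly den ?z) ^ (N - Suc 0)))
           = of_nat N * (q' / (poly num ?z / poly den ?z))" using nz by (simp add: field_simps)
        also have "q' / (poly num ?z / poly den ?z) = poly (pderiv num) ?z / poly num ?z - poly (pderiv den) ?z / poly den ?z"
          unfolding q'_def using nz by (simp add: field_simps)
        finally show ?thesis .
      qed
      ultimately show ?thesis by (simp only:)
    qed
    have "(cis has_vector_derivative (\<i> * cis t)) (at t)"
      unfolding cis_conv_exp
      by (rule has_vector_derivative_real_field[where f = "\<lambda>z. exp (\<i> * z)"])
         (auto intro!: derivative_eq_intros)
    from field_vector_diff_chain_at[OF this dV]
    have "(V \<circ> cis has_vector_derivative (\<i> * of_real (real N * poisson ?z))) (at t)"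
      using log_derivative[of ?z] by (simp add: mult_ac)
    from bounded_linear.has_vector_derivative[OF bounded_linear_Im this]
    show ?thesis by (simp add: has_real_derivative_iff_has_vector_derivative o_def)
  qed
  obtain t where t: "t0 < t" "t < t0 + e"
    "Im (V (cis (t0 + e))) - Im (V (cis t0)) = (t0 + e - t0) * (real N * poisson (cis t))"
    using MVT2[of t0 "t0 + e" "\<lambda>t. Im (V (cis t))" "\<lambda>t. real N * poisson (cis t)"] der e by auto
  \<comment> \<open>Here the threshold 32 enters: the growth is at least \<open>N / 4 >= 8\<close>,
    whereas two values of \<open>Im V\<close> differ by at most \<open>2 * pi < 8\<close>.\<close>
  have "(8::real) \<le> e * (real N * (1 / (4 * e)))" using N e by (simp add: field_simps)
  also have "\<dots> \<le> e * (real N * poisson (cis t))"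
    using large[of t] t e by (intro mult_left_mono) auto
  finally have "Im (V (cis (t0 + e))) - Im (V (cis t0)) \<ge> 8" using t(3) by simp
  moreover have "\<bar>Im (V (cis s))\<bar> \<le> pi" for s
  proof -
    have "(poly num (cis s) / poly den (cis s)) ^ N \<noteq> 0"
      using num_nonzero[of "cis s"] den_nonzero[of "cis s"] by simp
    thus ?thesis unfolding V_def using mpi_less_Im_Ln Im_Ln_le_pi
      by (smt (verit) neg_equal_0_iff_equal)
  qed
  ultimately show False using pi_less_4 by (smt (verit) abs_le_iff)
qed

text \<open>At a root \<open>num ^ N = den ^ N\<close>, so the derivative of \<open>D\<close> is
  \<open>N * num ^ N\<close> times the difference of the logarithmic derivatives of
  \<open>num\<close> and \<open>den\<close>. Positivity of \<open>poisson\<close> makes all roots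
  simple.\<close>

lemma level_polynomial:
  fixes N :: nat
  defines "D \<equiv> num ^ N - den ^ N"
  assumes N: "N > 0"
  shows "\<And>\<alpha>. poly D \<alpha> = 0 \<Longrightarrow> cmod \<alpha> = 1"
    and "\<And>\<alpha>. poly D \<alpha> = 0 \<Longrightarrow> \<alpha> * poly (pderiv D) \<alpha> = of_nat N * poly num \<alpha> ^ N * of_real (poisson \<alpha>)"
    and "rsquarefree D"
proof -
  show uni: "cmod \<alpha> = 1" if "poly D \<alpha> = 0" for \<alpha>
  proof -
    have "cmod (poly num \<alpha>) ^ N = cmod (poly den \<alpha>) ^ N"
      using that by (simp add: D_def norm_power[symmetric])
    hence "cmod (poly num \<alpha>) = cmod (poly den \<alpha>)"
      using N power_eq_iff_eq_base[of N "cmod (poly num \<alpha>)" "cmod (poly den \<alpha>)"] by simp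
    thus ?thesis by (rule unimodular_if_equal_cmod)
  qed
  show der: "\<alpha> * poly (pderiv D) \<alpha> = of_nat N * poly num \<alpha> ^ N * of_real (poisson \<alpha>)"
    if \<alpha>: "poly D \<alpha> = 0" for \<alpha>
  proof -
    let ?x = "poly num \<alpha>" and ?y = "poly den \<alpha>"
    let ?x' = "poly (pderiv num) \<alpha>" and ?y' = "poly (pderiv den) \<alpha>"
    have nz: "?x \<noteq> 0" "?y \<noteq> 0" using uni[OF \<alpha>] num_nonzero den_nonzero by auto
    obtain k where k: "N = Suc k" using N by (cases N) auto
    have e: "?x ^ N = ?y ^ N" using \<alpha> by (simp add: D_def)
    have "poly (pderiv D) \<alpha> = of_nat N * (?x ^ k * ?x' - ?y ^ k * ?y')"
      unfolding D_def k pderiv_diff pderiv_power_Suc by (simp add: algebra_simps)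
    also have "\<dots> = of_nat N * (?x ^ N * (?x' / ?x) - ?y ^ N * (?y' / ?y))"
      using nz by (simp add: k)
    also have "\<dots> = of_nat N * ?x ^ N * (?x' / ?x - ?y' / ?y)"
      unfolding e[symmetric] by (simp add: algebra_simps)
    finally show ?thesis
      unfolding log_derivative[OF uni[OF \<alpha>], symmetric] by (simp add: mult_ac)
  qed
  show "rsquarefree D"
    unfolding rsquarefree_roots
  proof safe
    fix \<alpha> assume \<alpha>: "poly D \<alpha> = 0" "poly (pderiv D) \<alpha> = 0"
    hence "of_nat N * poly num \<alpha> ^ N * complex_of_real (poisson \<alpha>) = 0" using der[of \<alpha>] by simp
    thus False using N num_nonzero[of \<alpha>] poisson_pos[of \<alpha>] uni[OF \<alpha>(1)] by auto
  qed
qed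

end

section \<open>Continuity of roots and local orders\<close>

lemma continuous_on_eval2 [continuous_intros]:
  assumes "continuous_on S f" "continuous_on S g"
  shows "continuous_on S (\<lambda>x. eval2 F (f x) (g x))"
  by (induction F) (auto intro!: continuous_intros assms)

lemma holomorphic_on_eval2: "(\<lambda>z. eval2 F z w) holomorphic_on S"
  unfolding poly_slice[symmetric] by (intro holomorphic_intros)

lemma eval2_equicontinuous:
  assumes "compact K" "e > 0"
  shows "\<exists>r>0. \<forall>z\<in>K. \<forall>w. dist w w0 < r \<longrightarrow> dist (eval2 F z w) (eval2 F z w0) \<le> e"
proof -
  have "continuous_on (UNIV \<times> K) (\<lambda>x. eval2 F (snd x) (fst x))"
    by (intro continuous_intros)
  then obtain X where X: "w0 \<in> X" "open X"
    "\<forall>x\<in>X \<inter> UNIV. \<forall>t\<in>K. dist (eval2 F (snd (x, t)) (fst (x, t))) (eval2 F (snd (w0, t)) (fst (w0, t))) \<le> e"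
    using continuous_on_prod_compactE[OF _ assms(1) UNIV_I assms(2)] by blast
  obtain r where "r > 0" "ball w0 r \<subseteq> X" using openE[OF X(2,1)] by blast
  thus ?thesis using X(3) by (intro exI[of _ r]) (auto simp: subset_iff dist_commute)
qed

lemma eval2_uniform_limit:
  assumes "compact K" "w \<longlonglongrightarrow> w0"
  shows "uniform_limit K (\<lambda>k z. eval2 F z (w k)) (\<lambda>z. eval2 F z w0) sequentially"
proof (rule uniform_limitI)
  fix e :: real assume "e > 0"
  then obtain r where r: "r > 0" "\<forall>z\<in>K. \<forall>v. dist v w0 < r \<longrightarrow> dist (eval2 F z v) (eval2 F z w0) \<le> e / 2"
    using eval2_equicontinuous[OF \<open>compact K\<close>, of "e / 2" w0 F] by auto
  have "eventually (\<lambda>k. dist (w k) w0 < r) sequentially"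
    using tendstoD[OF assms(2) r(1)] .
  thus "\<forall>\<^sub>F k in sequentially. \<forall>z\<in>K. dist (eval2 F z (w k)) (eval2 F z w0) < e"
    by eventually_elim (use r(2) \<open>e > 0\<close> in force)
qed

text \<open>This is Hurwitz's theorem read backwards: if all slices along the sequence were free of
  zeros in \<open>S\<close>, their nonconstant locally uniform limit would be so too.\<close>

lemma eval2_root_nearby:
  assumes "open S" "connected S" "z0 \<in> S" "eval2 F z0 w0 = 0"
    and nonconst: "\<not> (\<lambda>z. eval2 F z w0) constant_on S" and lim: "w \<longlonglongrightarrow> w0"
  shows "\<exists>k::nat. \<exists>z\<in>S. eval2 F z (w k) = 0"
proof (rule ccontr)
  assume "\<not> ?thesis"
  hence "eval2 F z0 w0 \<noteq> 0"
    using assms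
    by (intro Hurwitz_no_zeros[of S "\<lambda>k z. eval2 F z (w k)" "\<lambda>z. eval2 F z w0" z0]
        holomorphic_on_eval2 eval2_uniform_limit) auto
  thus False using assms by simp
qed

section \<open>The polynomials p and p~, and atorality\<close>

definition bipoly_poly :: "(nat \<Rightarrow> nat \<Rightarrow> complex) \<Rightarrow> nat \<Rightarrow> nat \<Rightarrow> complex poly poly" where
  "bipoly_poly c m n = (\<Sum>i\<le>m. monom (\<Sum>j\<le>n. monom (c i j) j) i)"

definition refl_bipoly_poly :: "(nat \<Rightarrow> nat \<Rightarrow> complex) \<Rightarrow> nat \<Rightarrow> nat \<Rightarrow> complex poly poly" where
  "refl_bipoly_poly c m n = (\<Sum>i\<le>m. monom (\<Sum>j\<le>n. monom (cnj (c i j)) (n - j)) (m - i))"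

lemma eval2_bipoly_poly [simp]: "eval2 (bipoly_poly c m n) z w = bipoly c m n z w"
  by (simp add: bipoly_poly_def bipoly_def poly_sum poly_monom sum_distrib_left sum_distrib_right mult_ac)

lemma eval2_refl_bipoly_poly [simp]: "eval2 (refl_bipoly_poly c m n) z w = refl_bipoly c m n z w"
  by (simp add: refl_bipoly_poly_def refl_bipoly_def poly_sum poly_monom sum_distrib_left sum_distrib_right mult_ac)

lemma refl_bipoly_eq:
  assumes "z \<noteq> 0" "w \<noteq> 0"
  shows "refl_bipoly c m n z w = z ^ m * w ^ n * cnj (bipoly c m n (1 / cnj z) (1 / cnj w))"
  unfolding refl_bipoly_def bipoly_def cnj_sum sum_distrib_left
  by (intro sum.cong refl) (use assms in \<open>simp add: power_diff power_divide\<close>)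

lemma bipoly_eq_refl:
  assumes "z \<noteq> 0" "w \<noteq> 0"
  shows "bipoly c m n z w = z ^ m * w ^ n * cnj (refl_bipoly c m n (1 / cnj z) (1 / cnj w))"
  using refl_bipoly_eq[of "1 / cnj z" "1 / cnj w" c m n] assms by (simp add: power_divide)

text \<open>Elimination works with prime factors, so atorality is recast as: common divisors are
  units. A constant common divisor is a unit unless it is 0.\<close>

lemma atoral_common_factor:
  assumes "atoral c m n" "f dvd bipoly_poly c m n" "f dvd refl_bipoly_poly c m n"
  shows "is_unit f"
proof -
  obtain r s where rs: "bipoly_poly c m n = f * r" "refl_bipoly_poly c m n = f * s" using assms(2,3) by (auto simp: dvd_def)
  have eq: "\<forall>z w. bipoly c m n z w = eval2 f z w * eval2 r z w"
       "\<forall>z w. refl_bipoly c m n z w = eval2 f z w * eval2 s z w"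
    by (simp_all flip: eval2_bipoly_poly eval2_refl_bipoly_poly add: rs)
  have "\<exists>k. \<forall>z w. eval2 f z w = k"
  proof (rule ccontr)
    assume "\<not> ?thesis"
    hence "\<not> atoral c m n" unfolding atoral_def not_not
      by (intro exI[of _ "eval2 f"] exI[of _ "eval2 r"] exI[of _ "eval2 s"] conjI eq)
         (auto simp: is_poly2_iff)
    thus False using assms(1) by simp
  qed
  then obtain k where k: "\<And>z w. eval2 f z w = k" by blast
  have f: "f = [:[:k:]:]" by (rule eval2_inject) (simp add: k)
  have "k \<noteq> 0"
  proof
    assume "k = 0"
    \<comment> \<open>Both polynomials would vanish identically, and then the coordinate function
      \<open>z\<close> would be a nonconstant common factor.\<close>
    hence z: "bipoly c m n = (\<lambda>_ _. 0)" "refl_bipoly c m n = (\<lambda>_ _. 0)"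
      using rs k by (auto simp: fun_eq_iff simp flip: eval2_bipoly_poly eval2_refl_bipoly_poly)
    have "is_poly2 (\<lambda>z w. z)" "is_poly2 (\<lambda>z w. 0)"
      unfolding is_poly2_iff
      by (intro exI[of _ "[:0, 1:]"] exI[of _ 0], simp add: fun_eq_iff)+
    moreover have "\<not> (\<exists>k. \<forall>(z :: complex) (w :: complex). z = k)"
      by (metis zero_neq_one)
    ultimately have "\<not> atoral c m n" unfolding atoral_def not_not
      by (intro exI[of _ "\<lambda>z w. z"] exI[of _ "\<lambda>z w. 0"] conjI) (auto simp: z)
    thus False using assms(1) by simp
  qed
  thus ?thesis unfolding f by (simp add: is_unit_const_poly_iff dvd_field_iff)
qed

text \<open>Once the full power of the linear factor is split off, the cofactor is nonzero at
  \<open>\<tau>\<close>. Nearby, its modulus stays between half and twice its modulus at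
  \<open>\<tau>\<close>.\<close>

lemma poly_order_bounds:
  fixes q :: "complex poly"
  assumes "q \<noteq> 0"
  obtains c1 c2 d where "c1 > 0" "c2 > 0" "d > 0"
    "\<And>z. 0 < cmod (\<tau> - z) \<Longrightarrow> cmod (\<tau> - z) < d \<Longrightarrow>
       c1 * cmod (\<tau> - z) powr real (order \<tau> q) \<le> cmod (poly q z) \<and>
       cmod (poly q z) \<le> c2 * cmod (\<tau> - z) powr real (order \<tau> q)"
proof -
  obtain s where s: "q = [:-\<tau>, 1:] ^ order \<tau> q * s" "\<not> [:-\<tau>, 1:] dvd s"
    using order_decomp[OF assms] by blast
  define l where "l = cmod (poly s \<tau>)"
  have l: "l > 0" using s(2) by (simp add: l_def poly_eq_0_iff_dvd)
  have "((\<lambda>z. cmod (poly s z)) \<longlongrightarrow> l) (at \<tau>)"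
    unfolding l_def by (intro tendsto_intros)
  hence "\<forall>\<^sub>F z in at \<tau>. dist (cmod (poly s z)) l < l / 2"
    using tendstoD l half_gt_zero by blast
  then obtain d where d: "d > 0" "\<And>z. z \<noteq> \<tau> \<Longrightarrow> dist z \<tau> < d \<Longrightarrow> dist (cmod (poly s z)) l < l / 2"
    unfolding eventually_at by auto
  show ?thesis
  proof (rule that[of "l / 2" "2 * l" d])
    fix z assume z: "0 < cmod (\<tau> - z)" "cmod (\<tau> - z) < d"
    hence ds: "dist (cmod (poly s z)) l < l / 2" by (intro d) (auto simp: dist_norm norm_minus_commute)
    have "cmod (poly q z) = cmod (\<tau> - z) ^ order \<tau> q * cmod (poly s z)"
      by (subst s(1)) (simp add: norm_mult norm_power norm_minus_commute)
    hence e: "cmod (poly q z) = cmod (poly s z) * cmod (\<tau> - z) powr real (order \<tau> q)"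
      using z by (simp add: powr_realpow)
    show "l / 2 * cmod (\<tau> - z) powr real (order \<tau> q) \<le> cmod (poly q z) \<and>
       cmod (poly q z) \<le> 2 * l * cmod (\<tau> - z) powr real (order \<tau> q)"
      unfolding e
    proof (intro conjI mult_right_mono)
      show "l / 2 \<le> cmod (poly s z)" "cmod (poly s z) \<le> 2 * l"
        using ds l unfolding dist_real_def by linarith+
    qed auto
  qed (use l d in auto)
qed

text \<open>Comparison at arbitrarily small points suffices: if \<open>K' > K\<close>, division by
  \<open>t powr K\<close> bounds the positive number \<open>A\<close> by a quantity tending to
  0.\<close>

lemma powr_exponent_le:
  fixes A B :: real
  assumes "A > 0" and small: "\<And>d. d > 0 \<Longrightarrow> \<exists>t. 0 < t \<and> t < d \<and> A * t powr K \<le> B * t powr K'"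
  shows "K' \<le> K"
proof (rule ccontr)
  assume "\<not> K' \<le> K"
  hence K: "K' - K > 0" by simp
  have "((\<lambda>t. B * t powr (K' - K)) \<longlongrightarrow> B * 0) (at_right 0)"
  proof (intro tendsto_mult tendsto_const)
    have "((\<lambda>t::real. t powr (K' - K)) \<longlongrightarrow> 0 powr (K' - K)) (at_right 0)"
      using K by (intro tendsto_powr' tendsto_intros) (auto simp: eventually_at_right_less less_imp_le eventually_mono[OF eventually_at_right_less])
    thus "((\<lambda>t. t powr (K' - K)) \<longlongrightarrow> 0) (at_right 0)" by simp
  qed
  hence "\<forall>\<^sub>F t in at_right 0. B * t powr (K' - K) < A"
    using \<open>A > 0\<close> by (intro order_tendstoD) auto
  then obtain d where d: "d > 0" "\<And>t. 0 < t \<Longrightarrow> t < d \<Longrightarrow> B * t powr (K' - K) < A"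
    unfolding eventually_at_right_field by auto
  obtain t where t: "0 < t" "t < d" "A * t powr K \<le> B * t powr K'" using small[OF d(1)] by blast
  have "A * t powr K \<le> (B * t powr (K' - K)) * t powr K"
    using t by (simp add: mult.assoc powr_add[symmetric])
  hence "A \<le> B * t powr (K' - K)" using t(1) by simp
  thus False using d(2)[OF t(1,2)] by simp
qed

section \<open>Slices of a stable atoral polynomial\<close>

lemma slice_eqI: "(\<And>z. eval2 F z w = poly q z) \<Longrightarrow> slice F w = q"
  by (simp add: poly_eq_poly_eq_iff[symmetric] fun_eq_iff)

lemma infinite_unit_circle: "infinite {z. cmod z = 1}"
proof
  assume "finite {z. cmod z = 1}"
  hence "finite (Re ` {z. cmod z = 1})" by (rule finite_imageI)
  moreover have "{-1..1} \<subseteq> Re ` {z. cmod z = 1}"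
  proof
    fix x :: real assume "x \<in> {-1..1}"
    hence "x = Re (cis (arccos x))" by simp
    thus "x \<in> Re ` {z. cmod z = 1}" by (rule image_eqI) simp
  qed
  ultimately have "finite {-1..1::real}" by (rule rev_finite_subset)
  thus False by (simp add: infinite_Icc)
qed

lemma inverse_cnj_unimodular: "cmod x = 1 \<Longrightarrow> 1 / cnj x = x"
proof -
  assume "cmod x = 1"
  hence "x * cnj x = 1" "cnj x \<noteq> 0" by (auto simp: complex_norm_square[symmetric])
  thus ?thesis by (metis nonzero_eq_divide_eq)
qed

lemma refl_bipoly_eq_0_on_torus:
  assumes "cmod z = 1" "cmod w = 1" "bipoly c m n z w = 0"
  shows "refl_bipoly c m n z w = 0"
proof -
  have "z \<noteq> 0" "w \<noteq> 0" using assms by auto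
  thus ?thesis using refl_bipoly_eq[of z w c m n] assms by (simp add: inverse_cnj_unimodular)
qed

text \<open>The hypotheses are symmetric in the two variables. The final proof interprets the locale
  for \<open>p\<close> and for \<open>p\<close> with its variables exchanged, so that only
  \<open>eps1\<close> and \<open>K1\<close> have to be studied.\<close>

locale stable_atoral =
  fixes c :: "nat \<Rightarrow> nat \<Rightarrow> complex" and m n :: nat
  assumes nz: "\<And>z w. cmod z < 1 \<Longrightarrow> cmod w < 1 \<Longrightarrow> bipoly c m n z w \<noteq> 0"
    and at: "atoral c m n"
    and sing_nonempty: "sing c m n \<noteq> {}"
begin

abbreviation "p \<equiv> bipoly c m n"
abbreviation "q \<equiv> refl_bipoly c m n"
abbreviation "PP \<equiv> bipoly_poly c m n"
abbreviation "RR \<equiv> refl_bipoly_poly c m n"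

text \<open>If \<open>m = 0\<close>, then \<open>p\<close> and \<open>p~\<close> depend on the
  second variable alone, and the second coordinate of a singularity gives them a common linear
  factor.\<close>

lemma m_pos: "m > 0"
proof (rule ccontr)
  assume "\<not> m > 0"
  hence m0: "m = 0" by simp
  obtain s t where st: "cmod s = 1" "cmod t = 1" "p s t = 0"
    using sing_nonempty unfolding sing_def by auto
  define f :: "complex poly poly" where "f = [:[:-t, 1:]:]"
  have P: "PP = [:\<Sum>j\<le>n. monom (c 0 j) j:]" and R: "RR = [:\<Sum>j\<le>n. monom (cnj (c 0 j)) (n - j):]"
    by (simp_all add: bipoly_poly_def refl_bipoly_poly_def m0 monom_0)
  have "eval2 PP s t = 0" "eval2 RR s t = 0"
    using st refl_bipoly_eq_0_on_torus[OF st] by simp_all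
  hence "f dvd PP" "f dvd RR"
    unfolding P R f_def by (simp_all add: poly_eq_0_iff_dvd)
  hence "is_unit f" by (rule atoral_common_factor[OF at])
  thus False unfolding f_def by (simp add: is_unit_const_poly_iff is_unit_poly_iff)
qed

text \<open>On the circle a zero would be a singularity. A zero inside the disc would persist, by
  Hurwitz, when \<open>\<zeta>\<close> is moved slightly into the disc, against stability. If the
  slice is constant, the zero reaches the circle.\<close>

lemma slice_nonzero:
  assumes "cmod \<zeta> = 1" "\<zeta> \<notin> snd ` sing c m n" "cmod z \<le> 1"
  shows "p z \<zeta> \<noteq> 0"
proof
  assume z: "p z \<zeta> = 0"
  have circle: "p w \<zeta> \<noteq> 0" if "cmod w = 1" for w
    using assms(1,2) that unfolding sing_def by force
  hence "cmod z < 1" using z assms(3) by force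
  define r :: "nat \<Rightarrow> complex" where "r k = of_real (1 - 1 / real (k + 2)) * \<zeta>" for k
  have l1: "(\<lambda>k. 1 - 1 / real (k + 2)) \<longlonglongrightarrow> 1 - 0"
    by (intro tendsto_diff tendsto_const LIMSEQ_ignore_initial_segment lim_1_over_n)
  have lim: "r \<longlonglongrightarrow> \<zeta>"
    unfolding r_def using tendsto_mult[OF tendsto_of_real[OF l1] tendsto_const[of \<zeta>]] by (simp only: diff_zero of_real_1 mult_1)
  have r: "cmod (r k) < 1" for k
    unfolding r_def norm_mult norm_of_real using assms(1) by (simp add: abs_less_iff field_simps)
  show False
  proof (cases "(\<lambda>w. eval2 PP w \<zeta>) constant_on ball 0 1")
    case True
    have "(\<lambda>w. eval2 PP w \<zeta>) constant_on closure (ball 0 1)"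
      by (rule constant_on_closureI[OF True]) (intro continuous_intros)
    hence "p 1 \<zeta> = p z \<zeta>" using \<open>cmod z < 1\<close> unfolding constant_on_def by force
    thus False using z circle[of 1] by simp
  next
    case False
    obtain k w where "w \<in> ball 0 1" "eval2 PP w (r k) = 0"
      using eval2_root_nearby[OF open_ball connected_ball _ _ False lim, of z] z \<open>cmod z < 1\<close> by auto
    thus False using nz[of w "r k"] r by simp
  qed
qed

text \<open>The slice of \<open>p~\<close> has degree exactly \<open>m\<close>, since its top
  coefficient is \<open>\<zeta> ^ n * cnj (p 0 \<zeta>)\<close>. Its roots are reflections of zeros
  of \<open>p\<close>, which \<open>slice_nonzero\<close> keeps out of the closed disc, so they lie
  inside.\<close>

lemma blaschke_slice:
  assumes \<zeta>: "cmod \<zeta> = 1" "\<zeta> \<notin> snd ` sing c m n"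
  obtains a C C' where "blaschke m a C C'" "slice RR \<zeta> = blaschke.num m a C"
    "slice PP \<zeta> = blaschke.den m a C'" "\<forall>z. q z \<zeta> = 0 \<longleftrightarrow> (\<exists>k<m. z = a k)"
proof -
  have \<zeta>c: "1 / cnj \<zeta> = \<zeta>" "\<zeta> \<noteq> 0"
    using \<zeta>(1) inverse_cnj_unimodular by auto
  define Q where "Q = slice RR \<zeta>"
  have coeff_m: "coeff Q m = \<zeta> ^ n * cnj (p 0 \<zeta>)"
  proof -
    have 1: "coeff RR m = (\<Sum>j\<le>n. monom (cnj (c 0 j)) (n - j))"
    proof -
      have "coeff RR m = (\<Sum>i\<le>m. if i = 0 then \<Sum>j\<le>n. monom (cnj (c i j)) (n - j) else 0)"
        unfolding refl_bipoly_poly_def coeff_sum by (intro sum.cong) (use m_pos in auto)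
      thus ?thesis by simp
    qed
    have 2: "p 0 \<zeta> = (\<Sum>j\<le>n. c 0 j * \<zeta> ^ j)"
    proof -
      have "p 0 \<zeta> = (\<Sum>i\<le>m. if i = 0 then \<Sum>j\<le>n. c i j * \<zeta> ^ j else 0)"
        unfolding bipoly_def by (intro sum.cong) (auto simp: power_0_left)
      thus ?thesis by simp
    qed
    have rf: "cnj (\<zeta> ^ j) * \<zeta> ^ n = \<zeta> ^ (n - j)" if "j \<le> n" for j
    proof -
      have "cnj \<zeta> * \<zeta> = 1" using \<zeta>c by (simp add: field_simps)
      hence "cnj (\<zeta> ^ j) * \<zeta> ^ j = 1" by (simp flip: power_mult_distrib)
      moreover have "\<zeta> ^ n = \<zeta> ^ j * \<zeta> ^ (n - j)" using that by (simp flip: power_add)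
      ultimately show ?thesis by (metis mult.assoc mult_1)
    qed
    have "\<zeta> ^ n * cnj (p 0 \<zeta>) = (\<Sum>j\<le>n. cnj (c 0 j) * \<zeta> ^ (n - j))"
      unfolding 2 cnj_sum sum_distrib_left by (intro sum.cong refl) (simp add: rf[symmetric] mult_ac)
    thus ?thesis unfolding Q_def by (simp add: 1 poly_sum poly_monom)
  qed
  have p0: "p 0 \<zeta> \<noteq> 0" using slice_nonzero[OF \<zeta>] by simp
  have degQ: "degree Q = m"
  proof (rule antisym)
    show "degree Q \<le> m"
      unfolding Q_def by (intro degree_le) (auto simp: refl_bipoly_poly_def coeff_sum poly_sum intro!: sum.neutral)
    show "m \<le> degree Q" using coeff_m p0 \<zeta>c by (intro le_degree) auto
  qed
  have "lead_coeff Q \<noteq> 0" using degQ m_pos by auto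
  obtain a where a: "smult (lead_coeff Q) (\<Prod>i<m. [:- a i, 1:]) = Q"
    using complex_poly_decompose'[of Q] degQ by metis
  define C where "C = lead_coeff Q"
  define C' where "C' = \<zeta> ^ n * cnj C"
  have Qe: "q z \<zeta> = C * (\<Prod>i<m. z - a i)" for z
  proof -
    have "q z \<zeta> = poly Q z" by (simp add: Q_def)
    also have "\<dots> = C * (\<Prod>i<m. z - a i)" by (subst a[symmetric]) (simp add: poly_prod C_def)
    finally show ?thesis .
  qed
  have roots: "q z \<zeta> = 0 \<longleftrightarrow> (\<exists>k<m. z = a k)" for z
    unfolding Qe using \<open>lead_coeff Q \<noteq> 0\<close> by (auto simp: C_def)
  have inside: "cmod (a k) < 1" if "k < m" for k
  proof (rule ccontr)
    assume *: "\<not> cmod (a k) < 1"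
    hence a0: "a k \<noteq> 0" by auto
    have "q (a k) \<zeta> = 0" using roots that by auto
    hence "p (1 / cnj (a k)) \<zeta> = 0"
      using refl_bipoly_eq[of "a k" \<zeta> c m n] \<zeta>c a0 by simp
    moreover have "cmod (1 / cnj (a k)) \<le> 1" using * by (simp add: norm_divide divide_le_eq_1)
    ultimately show False using slice_nonzero[OF \<zeta>] by blast
  qed
  have b: "blaschke m a C C'"
    by unfold_locales (use m_pos inside \<open>lead_coeff Q \<noteq> 0\<close> \<zeta>(1) in
      \<open>auto simp: C_def C'_def norm_mult norm_power\<close>)
  have pe: "p z \<zeta> = C' * (\<Prod>i<m. 1 - cnj (a i) * z)" if "z \<noteq> 0" for z
  proof -
    have "p z \<zeta> = C' * (z ^ m * (\<Prod>i<m. 1 / z - cnj (a i)))"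
      using bipoly_eq_refl[of z \<zeta> c m n] that \<zeta>c by (simp add: Qe C'_def mult_ac)
    also have "z ^ m * (\<Prod>i<m. 1 / z - cnj (a i)) = (\<Prod>i<m. z * (1 / z - cnj (a i)))"
      by (simp add: prod.distrib)
    finally show ?thesis using that by (simp add: right_diff_distrib mult.commute)
  qed
  \<comment> \<open>The reflection formula \<open>pe\<close> is available only for \<open>z\<close>
    different from 0; multiplying both sides by the variable covers the point 0.\<close>
  have "slice PP \<zeta> * [:0, 1:] = blaschke.den m a C' * [:0, 1:]"
    by (subst poly_eq_poly_eq_iff[symmetric])
      (auto simp: fun_eq_iff blaschke.poly_den[OF b] simp del: mult_pCons_right, use pe in blast)
  hence "slice PP \<zeta> = blaschke.den m a C'" by (metis mult_right_cancel pCons_eq_0_iff one_neq_zero)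
  moreover have "slice RR \<zeta> = blaschke.num m a C"
    by (rule slice_eqI) (simp add: blaschke.poly_num[OF b] Qe)
  ultimately show ?thesis using that[OF b] roots by blast
qed

lemma eps1_bounds:
  assumes \<zeta>: "cmod \<zeta> = 1" "\<zeta> \<notin> snd ` sing c m n"
    and roots: "\<forall>z. q z \<zeta> = 0 \<longleftrightarrow> (\<exists>k<m. z = a k)"
  shows "\<exists>k<m. eps1 c m n \<zeta> = 1 - cmod (a k)" and "\<And>k. k < m \<Longrightarrow> eps1 c m n \<zeta> \<le> 1 - cmod (a k)"
proof -
  let ?S = "(\<lambda>k. 1 - cmod (a k)) ` {..<m}"
  have "{1 - cmod z1 | z1. q z1 \<zeta> = 0} = ?S" using roots by auto
  hence e: "eps1 c m n \<zeta> = Inf ?S" unfolding eps1_def using \<zeta> by simp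
  have S: "finite ?S" "?S \<noteq> {}" using m_pos by auto
  hence e: "eps1 c m n \<zeta> = Min ?S" using e cInf_eq_Min by metis
  show "\<exists>k<m. eps1 c m n \<zeta> = 1 - cmod (a k)" using Min_in[OF S] e by auto
  show "eps1 c m n \<zeta> \<le> 1 - cmod (a k)" if "k < m" for k
    unfolding e using S that by (intro Min_le) auto
qed

text \<open>The set \<open>X\<close> collects the zeros of \<open>Den\<close>, among them all
  singular coordinates, and the points where \<open>D\<close> below loses degree. Off
  \<open>X\<close>, the modulus of \<open>Num / Den\<close> is the sum of \<open>poisson\<close>
  over the roots of the slice of \<open>D\<close>.\<close>

lemma eps1_rational:
  obtains Num Den :: "complex poly" and X M where "finite X" "M > 0" "snd ` sing c m n \<subseteq> X" "Num \<noteq> 0" "Den \<noteq> 0"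
    "\<And>\<zeta>. cmod \<zeta> = 1 \<Longrightarrow> \<zeta> \<notin> X \<Longrightarrow> cmod (poly Den \<zeta>) / (4 * cmod (poly Num \<zeta>)) \<le> eps1 c m n \<zeta>"
    "\<And>\<zeta>. cmod \<zeta> = 1 \<Longrightarrow> \<zeta> \<notin> X \<Longrightarrow> eps1 c m n \<zeta> \<le> M * (cmod (poly Den \<zeta>) / cmod (poly Num \<zeta>))"
proof -
  define N :: nat where "N = 32"
  have N: "N > 0" "N \<ge> 32" by (simp_all add: N_def)
  define D where "D = RR ^ N - PP ^ N"
  obtain s t where st: "cmod s = 1" "cmod t = 1" "p s t = 0"
    using sing_nonempty unfolding sing_def by auto
  have "RR \<noteq> 0"
  proof
    assume "RR = 0"
    hence "is_unit PP" by (intro atoral_common_factor[OF at]) auto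
    then obtain B where "PP * B = 1" by (metis dvdE)
    hence "eval2 PP s t * eval2 B s t = poly (poly 1 [:s:]) t"
      by (metis eval2_simps(5) eval2_def)
    thus False using st by simp
  qed
  hence "RR ^ N \<noteq> 0" by simp
  moreover have "False" if f: "prime_elem f" "degree f > 0" "f dvd RR ^ N" "f dvd D" for f
  proof -
    have "f dvd PP ^ N" using dvd_diff[OF f(3,4)] by (simp add: D_def)
    hence "f dvd PP" "f dvd RR" using f prime_elem_dvd_power by blast+
    hence "is_unit f" by (rule atoral_common_factor[OF at])
    thus False using f(1) by (simp add: prime_elem_def)
  qed
  ultimately obtain A B r where AB: "A * RR ^ N + B * D = [:r:]" "r \<noteq> 0"
    using elimination[of "RR ^ N" D] by metis
  \<comment> \<open>At a root of \<open>D\<close> this reads \<open>A * q ^ N = r\<close>. At a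
    singularity \<open>p\<close> and \<open>q\<close> both vanish, so \<open>r\<close> vanishes at
    every singular coordinate; hence there are only finitely many of these.\<close>
  have bezout: "eval2 A z w * q z w ^ N + eval2 B z w * eval2 D z w = poly r w" for z w
  proof -
    have "eval2 (A * RR ^ N + B * D) z w = eval2 [:r:] z w" using AB(1) by simp
    thus ?thesis by simp
  qed
  have slD: "slice D \<zeta> = slice RR \<zeta> ^ N - slice PP \<zeta> ^ N" for \<zeta>
    by (rule slice_eqI) (simp add: D_def)
  have sing_r: "poly r w = 0" if w: "w \<in> snd ` sing c m n" for w
  proof -
    obtain z where z: "cmod z = 1" "cmod w = 1" "p z w = 0"
      using w unfolding sing_def by auto
    thus ?thesis using bezout[of z w] refl_bipoly_eq_0_on_torus[OF z] by (simp add: D_def zero_power[OF N(1)])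
  qed
  have "finite (snd ` sing c m n)"
    by (rule finite_subset[OF _ poly_roots_finite[OF AB(2)]]) (use sing_r in auto)
  have ex_regular: "\<exists>\<zeta>. cmod \<zeta> = 1 \<and> \<zeta> \<notin> X" if "finite X" for X
    using infinite_unit_circle finite_subset[OF _ that, of "{z. cmod z = 1}"] by auto
  \<comment> \<open>A regular slice of \<open>D\<close> has a root by
    \<open>exists_large_poisson\<close>. If \<open>D\<close> were constant in the outer variable, 0
    would be a root as well, but all roots are unimodular.\<close>
  have D_not_const: "degree D > 0"
  proof (rule ccontr)
    assume "\<not> degree D > 0"
    then obtain d where d: "D = [:d:]" by (meson degree_eq_zeroE neq0_conv)
    obtain \<zeta> where \<zeta>: "cmod \<zeta> = 1" "\<zeta> \<notin> snd ` sing c m n"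
      using ex_regular[OF \<open>finite (snd ` sing c m n)\<close>] by blast
    obtain a C C' where b: "blaschke m a C C'" "slice RR \<zeta> = blaschke.num m a C"
      "slice PP \<zeta> = blaschke.den m a C'" by (rule blaschke_slice[OF \<zeta>])
    interpret blaschke m a C C' by fact
    obtain z where "poly num z ^ N = poly den z ^ N" using exists_large_poisson[OF m N(2)] by blast
    hence "poly (slice D \<zeta>) z = 0" unfolding slD b by simp
    hence "poly (slice D \<zeta>) 0 = 0" by (simp add: d)
    thus False using level_polynomial(1)[OF N(1), of 0] unfolding slD b by simp
  qed
  \<comment> \<open>The square of \<open>pderiv D\<close> leaves \<open>A * z * pderiv D\<close> in
    each summand. At a root this is \<open>N * A * q ^ N * poisson\<close>, which the Bezout
    relation turns into \<open>N * r * poisson\<close>, so the roots enter only through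
    \<open>poisson\<close>.\<close>
  obtain L Num :: "complex poly" where L: "L \<noteq> 0"
    "\<And>w. poly (lead_coeff D) w \<noteq> 0 \<Longrightarrow> rsquarefree (slice D w) \<Longrightarrow>
       (\<Sum>\<alpha> | eval2 D \<alpha> w = 0. eval2 ([:0, 1:] * A * pderiv D ^ 2) \<alpha> w / eval2 (pderiv D) \<alpha> w) * poly L w = poly Num w"
    using sum_roots_rational[OF D_not_const, of "[:0, 1:] * A * pderiv D ^ 2"] by blast
  define Den where "Den = smult (of_nat N) (r * L)"
  have Den: "Den \<noteq> 0" using N AB(2) L(1) by (simp add: Den_def)
  define X where "X = {w. poly (Den * lead_coeff D) w = 0}"
  have "Den * lead_coeff D \<noteq> 0" using Den D_not_const by auto
  hence X: "finite X" unfolding X_def by (rule poly_roots_finite)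
  have sing_X: "snd ` sing c m n \<subseteq> X" using sing_r by (auto simp: X_def Den_def)
  define M where "M = real (degree D) * (2 * real m)"
  have M: "M > 0" using D_not_const m_pos by (simp add: M_def)
  have main: "\<exists>G>0. cmod (poly Num \<zeta>) = G * cmod (poly Den \<zeta>) \<and> 1 / (4 * eps1 c m n \<zeta>) \<le> G \<and> G \<le> M / eps1 c m n \<zeta> \<and> eps1 c m n \<zeta> > 0"
    if \<zeta>: "cmod \<zeta> = 1" "\<zeta> \<notin> X" for \<zeta>
  proof -
    have \<zeta>2: "\<zeta> \<notin> snd ` sing c m n" using \<zeta> sing_X by blast
    obtain a C C' where b: "blaschke m a C C'" "slice RR \<zeta> = blaschke.num m a C"
      "slice PP \<zeta> = blaschke.den m a C'" and roots: "\<forall>z. q z \<zeta> = 0 \<longleftrightarrow> (\<exists>k<m. z = a k)"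
      by (rule blaschke_slice[OF \<zeta>(1) \<zeta>2])
    interpret blaschke m a C C' by fact
    define e where "e = eps1 c m n \<zeta>"
    obtain k where k: "k < m" "e = 1 - cmod (a k)"
      using eps1_bounds(1)[OF \<zeta>(1) \<zeta>2 roots] by (auto simp: e_def)
    have e: "e > 0" using k a by simp
    note level = level_polynomial[OF N(1), folded b(2,3), folded slD]
    have sD: "poly (num ^ N - den ^ N) z = eval2 D z \<zeta>" for z
      unfolding b(2,3)[symmetric] slD[symmetric] by simp
    define Z where "Z = {\<alpha>. eval2 D \<alpha> \<zeta> = 0}"
    have "poly (slice D \<zeta>) 0 \<noteq> 0" using level(1)[of 0] by auto
    hence "slice D \<zeta> \<noteq> 0" by (metis poly_0)
    hence finZ: "finite Z" using poly_roots_finite[of "slice D \<zeta>"] by (simp add: Z_def)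
    have cardZ: "card Z \<le> degree D"
    proof -
      have "card Z \<le> degree (slice D \<zeta>)"
        using card_poly_roots_bound[OF \<open>slice D \<zeta> \<noteq> 0\<close>] by (simp add: Z_def)
      also have "\<dots> \<le> degree D" by (intro degree_le) (auto simp: coeff_eq_0)
      finally show ?thesis .
    qed
    have Zuni: "cmod \<alpha> = 1" if "\<alpha> \<in> Z" for \<alpha> using level(1)[of \<alpha>] that by (simp add: Z_def)
    define G where "G = (\<Sum>\<alpha>\<in>Z. poisson \<alpha>)"
    have "(\<Sum>\<alpha>\<in>Z. eval2 ([:0, 1:] * A * pderiv D ^ 2) \<alpha> \<zeta> / eval2 (pderiv D) \<alpha> \<zeta>)
        = (\<Sum>\<alpha>\<in>Z. of_nat N * poly r \<zeta> * of_real (poisson \<alpha>))"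
    proof (intro sum.cong refl)
      fix \<alpha> assume \<alpha>: "\<alpha> \<in> Z"
      have d: "\<alpha> * eval2 (pderiv D) \<alpha> \<zeta> = of_nat N * q \<alpha> \<zeta> ^ N * of_real (poisson \<alpha>)"
        using level(2)[of \<alpha>] \<alpha> by (simp add: Z_def pderiv_slice flip: b(2))
      have "poly num \<alpha> \<noteq> 0" using num_nonzero[of \<alpha>] Zuni[OF \<alpha>] by simp
      hence q0: "q \<alpha> \<zeta> \<noteq> 0" by (simp flip: b(2))
      hence d0: "eval2 (pderiv D) \<alpha> \<zeta> \<noteq> 0" using d N poisson_pos[OF Zuni[OF \<alpha>]] by auto
      have "eval2 ([:0, 1:] * A * pderiv D ^ 2) \<alpha> \<zeta> / eval2 (pderiv D) \<alpha> \<zeta>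
          = eval2 A \<alpha> \<zeta> * (\<alpha> * eval2 (pderiv D) \<alpha> \<zeta>)"
        unfolding eval2_simps power2_eq_square using d0 by simp
      also have "\<dots> = of_nat N * (eval2 A \<alpha> \<zeta> * q \<alpha> \<zeta> ^ N) * of_real (poisson \<alpha>)"
        unfolding d by (simp add: mult_ac)
      also have "eval2 A \<alpha> \<zeta> * q \<alpha> \<zeta> ^ N = poly r \<zeta>" using bezout[of \<alpha> \<zeta>] \<alpha> by (simp add: Z_def)
      finally show "eval2 ([:0, 1:] * A * pderiv D ^ 2) \<alpha> \<zeta> / eval2 (pderiv D) \<alpha> \<zeta>
          = of_nat N * poly r \<zeta> * of_real (poisson \<alpha>)" .
    qed
    also have "\<dots> = of_nat N * poly r \<zeta> * of_real G"
      by (simp add: G_def sum_distrib_left)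
    finally have "of_nat N * poly r \<zeta> * of_real G * poly L \<zeta> = poly Num \<zeta>"
      using L(2)[of \<zeta>] \<zeta>(2) level(3) by (simp add: X_def Z_def)
    hence NG: "poly Num \<zeta> = of_real G * poly Den \<zeta>" by (simp add: Den_def mult_ac)
    have G_le: "G \<le> M / e"
    proof -
      have "G \<le> (\<Sum>\<alpha>\<in>Z. 2 * real m / e)"
        unfolding G_def using eps1_bounds(2)[OF \<zeta>(1) \<zeta>2 roots] e Zuni
        by (intro sum_mono poisson_le) (auto simp: e_def)
      also have "\<dots> = real (card Z) * (2 * real m / e)" by simp
      also have "\<dots> \<le> real (degree D) * (2 * real m / e)"
        using cardZ e by (intro mult_right_mono) auto
      finally show ?thesis by (simp add: M_def)
    qed
    have G_ge: "1 / (4 * e) \<le> G"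
    proof -
      obtain z where z: "cmod z = 1" "poly num z ^ N = poly den z ^ N" "poisson z \<ge> 1 / (4 * e)"
        using exists_large_poisson[OF k(1) N(2)] unfolding k(2) by blast
      hence "z \<in> Z" using sD[of z] by (simp add: Z_def)
      hence "poisson z \<le> G" unfolding G_def using finZ Zuni poisson_pos
        by (intro member_le_sum) (auto intro: less_imp_le)
      thus ?thesis using z by simp
    qed
    have "1 / (4 * e) > 0" using e by simp
    hence G0: "G > 0" using G_ge by linarith
    hence "cmod (poly Num \<zeta>) = G * cmod (poly Den \<zeta>)" by (simp add: NG norm_mult)
    thus ?thesis using G0 G_ge G_le e unfolding e_def by blast
  qed
  show ?thesis
  proof (rule that[OF X M sing_X _ Den])
    show "Num \<noteq> 0"
    proof
      assume "Num = 0"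
      moreover obtain \<zeta> where \<zeta>: "cmod \<zeta> = 1" "\<zeta> \<notin> X" using ex_regular[OF X] by blast
      ultimately have "poly Den \<zeta> = 0" using main[OF \<zeta>] by auto
      thus False using \<zeta> by (simp add: X_def)
    qed
    fix \<zeta> assume \<zeta>: "cmod \<zeta> = 1" "\<zeta> \<notin> X"
    obtain G where G: "G > 0" "cmod (poly Num \<zeta>) = G * cmod (poly Den \<zeta>)" "1 / (4 * eps1 c m n \<zeta>) \<le> G"
      "G \<le> M / eps1 c m n \<zeta>" "eps1 c m n \<zeta> > 0" using main[OF \<zeta>] by blast
    have Den0: "poly Den \<zeta> \<noteq> 0" using \<zeta> by (auto simp: X_def)
    show "cmod (poly Den \<zeta>) / (4 * cmod (poly Num \<zeta>)) \<le> eps1 c m n \<zeta>"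
      using G Den0 by (simp add: field_simps)
    show "eps1 c m n \<zeta> \<le> M * (cmod (poly Den \<zeta>) / cmod (poly Num \<zeta>))"
      using G Den0 by (simp add: field_simps)
  qed
qed

end

section \<open>Contact exponents\<close>

lemma unit_circle_nearby:
  assumes "cmod \<tau> = 1" "d > 0"
  obtains \<zeta> where "cmod \<zeta> = 1" "0 < cmod (\<tau> - \<zeta>)" "cmod (\<tau> - \<zeta>) < d"
proof -
  define s where "s = min (d / 2) 1"
  have s: "0 < s" "s < d" "s \<le> 1" using assms(2) by (auto simp: s_def)
  have "cos s < 1" using s cos_monotone_0_pi[of 0 s] pi_gt3 by simp
  hence "cis s \<noteq> 1" by (auto simp: complex_eq_iff)
  have "\<tau> - \<tau> * cis s = \<tau> * (cis 0 - cis s)" by (simp add: algebra_simps)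
  hence "cmod (\<tau> - \<tau> * cis s) = cmod (cis 0 - cis s)" using assms by (simp add: norm_mult)
  moreover have "cmod (cis 0 - cis s) \<le> s" using norm_diff_cis_le[of 0 s] s by simp
  moreover have "cmod (cis 0 - cis s) > 0" using \<open>cis s \<noteq> 1\<close> by simp
  ultimately show ?thesis using s assms by (intro that[of "\<tau> * cis s"]) (auto simp: norm_mult)
qed

context stable_atoral
begin

text \<open>The exponent is the order of \<open>Den\<close> at \<open>\<tau>\<close> minus that of
  \<open>Num\<close>. The bound \<open>d0\<close> is the degree of \<open>Den\<close>; being
  independent of \<open>\<tau>\<close>, it will bound the set whose supremum is
  \<open>K1\<close>.\<close>

lemma eps1_asymptotic_power:
  obtains d0 where "\<And>\<tau>. \<exists>K c1 c2 \<delta>. K \<le> d0 \<and> K \<in> \<rat> \<and> c1 > 0 \<and> c2 > 0 \<and> \<delta> > 0 \<and>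
    (\<forall>\<zeta>. cmod \<zeta> = 1 \<longrightarrow> 0 < cmod (\<tau> - \<zeta>) \<longrightarrow> cmod (\<tau> - \<zeta>) < \<delta> \<longrightarrow>
      c1 * cmod (\<tau> - \<zeta>) powr K \<le> eps1 c m n \<zeta> \<and> eps1 c m n \<zeta> \<le> c2 * cmod (\<tau> - \<zeta>) powr K)"
proof -
  obtain Num Den :: "complex poly" and X M where X: "finite X" and M: "M > 0"
    and ne: "Num \<noteq> 0" "Den \<noteq> 0"
    and lower: "\<And>\<zeta>. cmod \<zeta> = 1 \<Longrightarrow> \<zeta> \<notin> X \<Longrightarrow> cmod (poly Den \<zeta>) / (4 * cmod (poly Num \<zeta>)) \<le> eps1 c m n \<zeta>"
    and upper: "\<And>\<zeta>. cmod \<zeta> = 1 \<Longrightarrow> \<zeta> \<notin> X \<Longrightarrow> eps1 c m n \<zeta> \<le> M * (cmod (poly Den \<zeta>) / cmod (poly Num \<zeta>))"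
    using eps1_rational by metis
  show ?thesis
  proof (rule that[of "real (degree Den)"])
    fix \<tau> :: complex
    obtain a1 a2 d where a: "a1 > 0" "a2 > 0" "d > 0" "\<And>z. 0 < cmod (\<tau> - z) \<Longrightarrow> cmod (\<tau> - z) < d \<Longrightarrow>
       a1 * cmod (\<tau> - z) powr real (order \<tau> Num) \<le> cmod (poly Num z) \<and>
       cmod (poly Num z) \<le> a2 * cmod (\<tau> - z) powr real (order \<tau> Num)"
      by (rule poly_order_bounds[OF ne(1), of \<tau>]) blast
    obtain b1 b2 d' where b: "b1 > 0" "b2 > 0" "d' > 0" "\<And>z. 0 < cmod (\<tau> - z) \<Longrightarrow> cmod (\<tau> - z) < d' \<Longrightarrow>
       b1 * cmod (\<tau> - z) powr real (order \<tau> Den) \<le> cmod (poly Den z) \<and>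
       cmod (poly Den z) \<le> b2 * cmod (\<tau> - z) powr real (order \<tau> Den)"
      by (rule poly_order_bounds[OF ne(2), of \<tau>]) blast
    obtain d'' where d'': "d'' > 0" "\<And>x. x \<in> X \<Longrightarrow> x \<noteq> \<tau> \<Longrightarrow> d'' \<le> dist \<tau> x"
      using finite_set_avoid[OF X, of \<tau>] by blast
    define K where "K = real (order \<tau> Den) - real (order \<tau> Num)"
    show "\<exists>K c1 c2 \<delta>. K \<le> real (degree Den) \<and> K \<in> \<rat> \<and> c1 > 0 \<and> c2 > 0 \<and> \<delta> > 0 \<and>
      (\<forall>\<zeta>. cmod \<zeta> = 1 \<longrightarrow> 0 < cmod (\<tau> - \<zeta>) \<longrightarrow> cmod (\<tau> - \<zeta>) < \<delta> \<longrightarrow>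
        c1 * cmod (\<tau> - \<zeta>) powr K \<le> eps1 c m n \<zeta> \<and> eps1 c m n \<zeta> \<le> c2 * cmod (\<tau> - \<zeta>) powr K)"
    proof (intro exI conjI allI impI)
      show "K \<le> real (degree Den)" using order_degree[OF ne(2), of \<tau>] by (simp add: K_def)
      show "K \<in> \<rat>" by (simp add: K_def)
      show "b1 / (4 * a2) > 0" "M * (b2 / a1) > 0" using a b M by auto
      show "min d (min d' d'') > 0" using a b d'' by simp
      fix \<zeta> assume \<zeta>: "cmod \<zeta> = 1" "0 < cmod (\<tau> - \<zeta>)" "cmod (\<tau> - \<zeta>) < min d (min d' d'')"
      have "\<zeta> \<notin> X" using d''(2)[of \<zeta>] \<zeta> by (auto simp: dist_norm)
      note \<zeta>X = \<zeta>(1) this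
      define t where "t = cmod (\<tau> - \<zeta>)"
      have t: "t > 0" using \<zeta> by (simp add: t_def)
      have A: "a1 * t powr real (order \<tau> Num) \<le> cmod (poly Num \<zeta>)" "cmod (poly Num \<zeta>) \<le> a2 * t powr real (order \<tau> Num)"
        using a(4)[of \<zeta>] \<zeta> by (auto simp: t_def)
      have B: "b1 * t powr real (order \<tau> Den) \<le> cmod (poly Den \<zeta>)" "cmod (poly Den \<zeta>) \<le> b2 * t powr real (order \<tau> Den)"
        using b(4)[of \<zeta>] \<zeta> by (auto simp: t_def)
      have pos: "a1 * t powr real (order \<tau> Num) > 0" "b1 * t powr real (order \<tau> Den) > 0"
        using a b t by auto
      have "b1 / (4 * a2) * t powr K = (b1 * t powr real (order \<tau> Den)) / (4 * (a2 * t powr real (order \<tau> Num)))"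
        by (simp add: K_def powr_diff)
      also have "\<dots> \<le> cmod (poly Den \<zeta>) / (4 * cmod (poly Num \<zeta>))"
        using A B pos by (intro frac_le) auto
      also have "\<dots> \<le> eps1 c m n \<zeta>" by (rule lower[OF \<zeta>X])
      finally show "b1 / (4 * a2) * cmod (\<tau> - \<zeta>) powr K \<le> eps1 c m n \<zeta>" by (simp add: t_def)
      have "eps1 c m n \<zeta> \<le> M * (cmod (poly Den \<zeta>) / cmod (poly Num \<zeta>))" by (rule upper[OF \<zeta>X])
      also have "\<dots> \<le> M * ((b2 * t powr real (order \<tau> Den)) / (a1 * t powr real (order \<tau> Num)))"
        using A B pos M b t by (intro mult_left_mono frac_le) auto
      also have "\<dots> = M * (b2 / a1) * t powr K"
        by (simp add: K_def powr_diff)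
      finally show "eps1 c m n \<zeta> \<le> M * (b2 / a1) * cmod (\<tau> - \<zeta>) powr K" by (simp add: t_def)
    qed
  qed
qed

text \<open>A lower bound for a real \<open>Sup\<close> needs boundedness of the set and a member.
  Both come from the two-sided power behaviour of \<open>eps1\<close>, so the hypothesis is required
  only at points accumulating at the singular coordinate.\<close>

lemma K1_ge:
  assumes \<tau>: "\<tau> \<in> sing c m n" and "\<kappa> > 0"
    and small: "\<And>d. d > 0 \<Longrightarrow> \<exists>\<zeta>. cmod \<zeta> = 1 \<and> 0 < cmod (snd \<tau> - \<zeta>) \<and> cmod (snd \<tau> - \<zeta>) < d \<and>
      eps1 c m n \<zeta> \<le> B * cmod (snd \<tau> - \<zeta>) powr \<kappa>"
  shows "K1 c m n \<ge> \<kappa>"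
proof -
  obtain d0 where d0: "\<And>\<tau>. \<exists>K c1 c2 \<delta>. K \<le> d0 \<and> K \<in> \<rat> \<and> c1 > 0 \<and> c2 > 0 \<and> \<delta> > 0 \<and>
    (\<forall>\<zeta>. cmod \<zeta> = 1 \<longrightarrow> 0 < cmod (\<tau> - \<zeta>) \<longrightarrow> cmod (\<tau> - \<zeta>) < \<delta> \<longrightarrow>
      c1 * cmod (\<tau> - \<zeta>) powr K \<le> eps1 c m n \<zeta> \<and> eps1 c m n \<zeta> \<le> c2 * cmod (\<tau> - \<zeta>) powr K)"
    using eps1_asymptotic_power by blast
  let ?S = "{K. \<exists>\<sigma>\<in>sing c m n. contact_exp (eps1 c m n) (snd \<sigma>) K}"
  have "bdd_above ?S"
  proof (rule bdd_aboveI[of _ d0])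
    fix K' assume "K' \<in> ?S"
    then obtain \<sigma> where \<sigma>: "\<sigma> \<in> sing c m n" "contact_exp (eps1 c m n) (snd \<sigma>) K'" by blast
    obtain C2 \<delta>' where C2: "\<delta>' > 0" "\<And>\<zeta>. cmod \<zeta> = 1 \<Longrightarrow> cmod (snd \<sigma> - \<zeta>) < \<delta>' \<Longrightarrow> eps1 c m n \<zeta> \<le> C2 * cmod (snd \<sigma> - \<zeta>) powr K'"
      using \<sigma>(2) unfolding contact_exp_def by blast
    obtain K c1 \<delta> where K: "K \<le> d0" "c1 > 0" "\<delta> > 0"
      "\<And>\<zeta>. cmod \<zeta> = 1 \<Longrightarrow> 0 < cmod (snd \<sigma> - \<zeta>) \<Longrightarrow> cmod (snd \<sigma> - \<zeta>) < \<delta> \<Longrightarrow> c1 * cmod (snd \<sigma> - \<zeta>) powr K \<le> eps1 c m n \<zeta>"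
      using d0[of "snd \<sigma>"] by blast
    have "cmod (snd \<sigma>) = 1" using \<sigma>(1) by (auto simp: sing_def)
    have "K' \<le> K"
    proof (rule powr_exponent_le[OF K(2)])
      fix d :: real assume "d > 0"
      obtain \<zeta> where \<zeta>: "cmod \<zeta> = 1" "0 < cmod (snd \<sigma> - \<zeta>)" "cmod (snd \<sigma> - \<zeta>) < min d (min \<delta> \<delta>')"
        by (rule unit_circle_nearby[OF \<open>cmod (snd \<sigma>) = 1\<close>, of "min d (min \<delta> \<delta>')"])
          (use \<open>d > 0\<close> K(3) C2(1) in auto)
      thus "\<exists>t. 0 < t \<and> t < d \<and> c1 * t powr K \<le> C2 * t powr K'"
        using K(4)[of \<zeta>] C2(2)[of \<zeta>] by (intro exI[of _ "cmod (snd \<sigma> - \<zeta>)"]) auto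
    qed
    thus "K' \<le> d0" using K(1) by simp
  qed
  obtain K c1 c2 \<delta> where K: "K \<in> \<rat>" "c1 > 0" "c2 > 0" "\<delta> > 0"
    "\<And>\<zeta>. cmod \<zeta> = 1 \<Longrightarrow> 0 < cmod (snd \<tau> - \<zeta>) \<Longrightarrow> cmod (snd \<tau> - \<zeta>) < \<delta> \<Longrightarrow>
      c1 * cmod (snd \<tau> - \<zeta>) powr K \<le> eps1 c m n \<zeta> \<and> eps1 c m n \<zeta> \<le> c2 * cmod (snd \<tau> - \<zeta>) powr K"
    using d0[of "snd \<tau>"] by blast
  have "\<kappa> \<le> K"
  proof (rule powr_exponent_le[OF K(2)])
    fix d :: real assume "d > 0"
    then obtain \<zeta> where \<zeta>: "cmod \<zeta> = 1" "0 < cmod (snd \<tau> - \<zeta>)" "cmod (snd \<tau> - \<zeta>) < min d \<delta>"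
      "eps1 c m n \<zeta> \<le> B * cmod (snd \<tau> - \<zeta>) powr \<kappa>" using small[of "min d \<delta>"] K(4) by auto
    thus "\<exists>t. 0 < t \<and> t < d \<and> c1 * t powr K \<le> B * t powr \<kappa>"
      using K(5)[of \<zeta>] by (intro exI[of _ "cmod (snd \<tau> - \<zeta>)"]) auto
  qed
  have "contact_exp (eps1 c m n) (snd \<tau>) K"
    unfolding contact_exp_def
  proof (intro conjI exI allI impI)
    fix \<zeta> assume \<zeta>: "cmod \<zeta> = 1 \<and> cmod (snd \<tau> - \<zeta>) < \<delta>"
    \<comment> \<open>A contact exponent must also satisfy its estimates at the centre, where
      \<open>eps1\<close> is 0 by convention and \<open>0 powr K = 0\<close>.\<close>
    have "eps1 c m n (snd \<tau>) = 0" using \<tau> by (simp add: eps1_def)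
    thus "c1 * cmod (snd \<tau> - \<zeta>) powr K \<le> eps1 c m n \<zeta>" "eps1 c m n \<zeta> \<le> c2 * cmod (snd \<tau> - \<zeta>) powr K"
      using K(5)[of \<zeta>] \<zeta> by (cases "\<zeta> = snd \<tau>"; force)+
  qed (use K \<open>\<kappa> \<le> K\<close> \<open>\<kappa> > 0\<close> in auto)
  hence "K \<in> ?S" using \<tau> by blast
  hence "K \<le> Sup ?S" using \<open>bdd_above ?S\<close> by (rule cSup_upper)
  thus ?thesis using \<open>\<kappa> \<le> K\<close> by (simp add: K1_def)
qed

end

section \<open>Blow-up and residues\<close>

text \<open>The blow-up \<open>(u, x) \<mapsto> (u * x, x)\<close> turns the lowest homogeneous part of a polynomial into the
  restriction to \<open>x = 0\<close> of what remains after removing the maximal power of \<open>x\<close>.\<close>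

lemma blow_up_exists: "\<exists>G. \<forall>u x. eval2 G u x = eval2 F (u * x) x"
proof (induction F)
  case 0 show ?case by (intro exI[of _ 0]) simp
next
  case (pCons a F)
  then obtain G where G: "\<forall>u x. eval2 G u x = eval2 F (u * x) x" by blast
  show ?case
    by (intro exI[of _ "[:a:] + [:0, [:0, 1:]:] * G"]) (simp add: G)
qed

lemma extract_power_of_inner_variable:
  fixes F :: "complex poly poly"
  assumes "F \<noteq> 0"
  obtains M H where "F = smult ([:0, 1:] ^ M) H" "slice H 0 \<noteq> 0"
proof -
  have "content F \<noteq> 0" using assms by simp
  then obtain g where g: "content F = [:-0, 1:] ^ order 0 (content F) * g" "\<not> [:-0, 1:] dvd g"
    using order_decomp by blast
  define H where "H = smult g (primitive_part F)"
  have "F = smult (content F) (primitive_part F)" by simp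
  hence 1: "F = smult ([:0, 1:] ^ order 0 (content F)) H" unfolding H_def using g(1)
    by (metis smult_smult neg_equal_iff_equal add.inverse_neutral)
  have g0: "poly g 0 \<noteq> 0" using g(2) by (simp add: poly_eq_0_iff_dvd)
  have "slice H 0 \<noteq> 0"
  proof
    assume "slice H 0 = 0"
    hence "poly (coeff H k) 0 = 0" for k by (metis coeff_slice coeff_0)
    hence "poly (coeff (primitive_part F) k) 0 = 0" for k using g0 by (auto simp: H_def)
    hence "[:0, 1:] dvd coeff (primitive_part F) k" for k
      by (metis poly_eq_0_iff_dvd add.inverse_neutral)
    hence "[:0, 1:] dvd content (primitive_part F)" 
      by (simp flip: const_poly_dvd_iff_dvd_content add: const_poly_dvd_iff)
    thus False using assms by (simp add: is_unit_poly_iff)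
  qed
  thus ?thesis using 1 that by blast
qed

lemma blow_up:
  assumes "F \<noteq> 0"
  obtains M H where "\<And>u x. eval2 F (u * x) x = x ^ M * eval2 H u x" "slice H 0 \<noteq> 0"
proof -
  obtain G where G: "\<forall>u x. eval2 G u x = eval2 F (u * x) x" using blow_up_exists by blast
  have "G \<noteq> 0"
  proof
    assume "G = 0"
    \<comment> \<open>The blow-up reaches every point off the line \<open>x = 0\<close>, so
      \<open>F\<close> would vanish there, and its product with the inner variable would vanish
      everywhere.\<close>
    hence *: "eval2 F y x = 0" if "x \<noteq> 0" for x y
      using G[rule_format, of "y / x" x] that by simp
    have "smult [:0, 1:] F = 0"
      by (rule eval2_inject) (use * in auto)
    thus False using assms by simp
  qed
  then obtain M H where MH: "G = smult ([:0, 1:] ^ M) H" "slice H 0 \<noteq> 0"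
    using extract_power_of_inner_variable by blast
  show ?thesis
  proof (rule that[OF _ MH(2)])
    fix u x show "eval2 F (u * x) x = x ^ M * eval2 H u x"
      using G[rule_format, of u x] by (simp add: MH(1))
  qed
qed

lemma eq_at_0_if_eq_elsewhere:
  fixes f g :: "complex \<Rightarrow> complex"
  assumes "continuous_on UNIV f" "continuous_on UNIV g" "\<And>x. x \<noteq> 0 \<Longrightarrow> f x = g x"
  shows "f 0 = g 0"
proof -
  have "(f \<longlongrightarrow> f 0) (at 0)" "(g \<longlongrightarrow> g 0) (at 0)"
    using assms(1,2) by (auto simp: continuous_on_def)
  moreover have "(f \<longlongrightarrow> g 0) (at 0) \<longleftrightarrow> (g \<longlongrightarrow> g 0) (at 0)"
    by (intro filterlim_cong refl) (use assms(3) in \<open>auto simp: eventually_at intro!: exI[of _ 1]\<close>)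
  ultimately show ?thesis using tendsto_unique[of "at (0::complex)" f] by (metis trivial_limit_at)
qed

text \<open>If both restrictions were constant, the lowest homogeneous part of \<open>P\<close> would be a power of
  each variable.\<close>

lemma blow_up_nonconstant_one_way:
  assumes H: "\<And>u x. eval2 P (u * x) x = x ^ M * eval2 H u x" "slice H 0 \<noteq> 0"
    and H': "\<And>u x. eval2 P' (u * x) x = x ^ M' * eval2 H' u x" "slice H' 0 \<noteq> 0"
    and swap: "\<And>x y. eval2 P' x y = eval2 P y x" and P0: "eval2 P 0 0 = 0"
  shows "degree (slice H 0) > 0 \<or> degree (slice H' 0) > 0"
proof (rule ccontr)
  assume "\<not> ?thesis"
  then obtain a a' where a: "slice H 0 = [:a:]" "slice H' 0 = [:a':]"
    by (meson degree_eq_zeroE neq0_conv)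
  hence a0: "a \<noteq> 0" "a' \<noteq> 0" using H(2) H'(2) by auto
  have e: "eval2 H u 0 = a" "eval2 H' u 0 = a'" for u
    by (metis a(1) poly_const_conv poly_slice, metis a(2) poly_const_conv poly_slice)
  have M: "M > 0" using H(1)[of 0 0] P0 a0 by (cases M) (auto simp: e)
  \<comment> \<open>Both blow-ups describe \<open>P\<close> at the point \<open>(x, u * x)\<close>,
    one with slope \<open>1 / u\<close> and the other with slope \<open>u\<close>.\<close>
  have key: "(u * x) ^ M * eval2 H (1 / u) (u * x) = x ^ M' * eval2 H' u x" if "u \<noteq> 0" for u x
    using H(1)[of "1 / u" "u * x"] H'(1)[of u x] swap[of "u * x" x] that by simp
  show False
  proof (cases "M \<le> M'")
    case True
    have "u ^ M * a = 0 ^ (M' - M) * a'" if "u \<noteq> 0" for u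
    proof -
      have "u ^ M * eval2 H (1 / u) (u * 0) = 0 ^ (M' - M) * eval2 H' u 0"
      proof (rule eq_at_0_if_eq_elsewhere[of "\<lambda>x. u ^ M * eval2 H (1 / u) (u * x)" "\<lambda>x. x ^ (M' - M) * eval2 H' u x"])
        fix x :: complex assume x: "x \<noteq> 0"
        have "x ^ M' = x ^ M * x ^ (M' - M)" using True by (simp flip: power_add)
        thus "u ^ M * eval2 H (1 / u) (u * x) = x ^ (M' - M) * eval2 H' u x"
          using key[OF that, of x] x by (simp add: power_mult_distrib)
      qed (intro continuous_intros)+
      thus ?thesis by (simp add: e)
    qed
    \<comment> \<open>The right side does not depend on \<open>u\<close>, so \<open>u ^ M\<close>
      would take the same value at 1 and at 2, although \<open>M > 0\<close>.\<close>
    from this[of 1] this[of 2] have "2 ^ M * a = a" by simp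
    hence "(2::complex) ^ M = 1" using a0 by simp
    hence "cmod (2 ^ M) = 1" by simp
    hence "(2::real) ^ M = 1" by (simp add: norm_power)
    thus False using one_less_power[of "2::real" M] M by simp
  next
    case False
    have "0 ^ (M - M') * eval2 H (1 / 1) (1 * 0) = eval2 H' 1 0"
    proof (rule eq_at_0_if_eq_elsewhere[of "\<lambda>x. x ^ (M - M') * eval2 H (1 / 1) (1 * x)" "\<lambda>x. eval2 H' 1 x"])
      fix x :: complex assume x: "x \<noteq> 0"
      have "x ^ M = x ^ M' * x ^ (M - M')" using False by (simp flip: power_add)
      thus "x ^ (M - M') * eval2 H (1 / 1) (1 * x) = eval2 H' 1 x"
        using key[of 1 x] x by simp
    qed (intro continuous_intros)+
    thus False using False a0 by (simp add: e zero_power)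
  qed
qed

section \<open>The Cayley change of variables\<close>

definition halfplane_poly :: "(nat \<Rightarrow> nat \<Rightarrow> complex) \<Rightarrow> nat \<Rightarrow> nat \<Rightarrow> complex \<Rightarrow> complex \<Rightarrow> complex poly poly" where
  "halfplane_poly d m n t1 t2 = (\<Sum>i\<le>m. \<Sum>j\<le>n. [:[:d i j * t1 ^ i * t2 ^ j:]:] *
     ([:1, [:\<i>:]:] ^ i * [:1, [:-\<i>:]:] ^ (m - i)) * ([:[:1, \<i>:]:] ^ j * [:[:1, -\<i>:]:] ^ (n - j)))"

lemma eval2_halfplane_poly_expand:
  "eval2 (halfplane_poly d m n t1 t2) w1 w2 = (\<Sum>i\<le>m. \<Sum>j\<le>n. d i j * t1 ^ i * t2 ^ j *
     ((1 + \<i> * w1) ^ i * (1 - \<i> * w1) ^ (m - i)) * ((1 + \<i> * w2) ^ j * (1 - \<i> * w2) ^ (n - j)))"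
  by (simp add: halfplane_poly_def mult_ac del: mult_pCons_left mult_pCons_right)

text \<open>A monomial of degree \<open>i\<close> in the first variable uses \<open>i\<close> of the
  \<open>m\<close> factors \<open>1 - \<i> * w1\<close> to clear the denominators of
  \<open>cayley\<close>; the remaining \<open>m - i\<close> stay. The second variable is treated
  alike.\<close>

lemma eval2_halfplane_poly:
  assumes "1 - \<i> * w1 \<noteq> 0" "1 - \<i> * w2 \<noteq> 0"
  shows "eval2 (halfplane_poly d m n t1 t2) w1 w2
    = (1 - \<i> * w1) ^ m * (1 - \<i> * w2) ^ n * bipoly d m n (t1 * cayley w1) (t2 * cayley w2)"
  unfolding eval2_halfplane_poly_expand bipoly_def sum_distrib_left
proof (intro sum.cong refl)
  fix i j assume "i \<in> {..m}" "j \<in> {..n}"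
  hence "(1 - \<i> * w1) ^ m = (1 - \<i> * w1) ^ (m - i) * (1 - \<i> * w1) ^ i"
    "(1 - \<i> * w2) ^ n = (1 - \<i> * w2) ^ (n - j) * (1 - \<i> * w2) ^ j"
    by (auto simp flip: power_add)
  thus "d i j * t1 ^ i * t2 ^ j * ((1 + \<i> * w1) ^ i * (1 - \<i> * w1) ^ (m - i)) *
      ((1 + \<i> * w2) ^ j * (1 - \<i> * w2) ^ (n - j))
    = (1 - \<i> * w1) ^ m * (1 - \<i> * w2) ^ n * (d i j * (t1 * cayley w1) ^ i * (t2 * cayley w2) ^ j)"
    using assms by (simp add: cayley_def power_mult_distrib power_divide)
qed

lemma eval2_halfplane_poly_swap:
  "eval2 (halfplane_poly (\<lambda>j i. d i j) n m t2 t1) w2 w1 = eval2 (halfplane_poly d m n t1 t2) w1 w2"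
  unfolding eval2_halfplane_poly_expand by (subst sum.swap) (simp add: mult_ac)

lemma bipoly_swap: "bipoly (\<lambda>j i. d i j) n m w z = bipoly d m n z w"
  unfolding bipoly_def by (subst sum.swap) (simp add: mult_ac)

lemma refl_bipoly_swap: "refl_bipoly (\<lambda>j i. d i j) n m w z = refl_bipoly d m n z w"
  unfolding refl_bipoly_def by (subst sum.swap) (simp add: mult_ac)

text \<open>Reversed and conjugated coefficients present \<open>p~\<close> as a
  \<open>bipoly\<close> of the same format, so that \<open>halfplane_poly\<close> applies to
  it.\<close>

definition refl_coeffs :: "(nat \<Rightarrow> nat \<Rightarrow> complex) \<Rightarrow> nat \<Rightarrow> nat \<Rightarrow> nat \<Rightarrow> nat \<Rightarrow> complex" where
  "refl_coeffs c m n i j = cnj (c (m - i) (n - j))"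

lemma bipoly_refl_coeffs: "bipoly (refl_coeffs c m n) m n z w = refl_bipoly c m n z w"
proof -
  have rev: "(\<Sum>i\<le>k. f (k - i) i) = (\<Sum>i\<le>k. f i (k - i))" for f :: "nat \<Rightarrow> nat \<Rightarrow> complex" and k
    by (rule sum.reindex_bij_witness[of _ "\<lambda>i. k - i" "\<lambda>i. k - i"]) auto
  show ?thesis
    unfolding bipoly_def refl_bipoly_def refl_coeffs_def
    using rev[of "\<lambda>i i'. \<Sum>j\<le>n. cnj (c i (n - j)) * z ^ i' * w ^ j" m]
      rev[of "\<lambda>j j'. cnj (c _ j) * z ^ _ * w ^ j'" n]
    by simp
qed

section \<open>Residues of quotients of polynomials\<close>

lemma residue_poly_quotient:
  fixes S P :: "complex poly"
  assumes "poly P u = 0" "poly (pderiv P) u \<noteq> 0"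
  shows "residue (\<lambda>z. poly S z / poly P z) u = poly S u / poly (pderiv P) u"
proof -
  obtain V where V: "P = [:-u, 1:] * V" using assms(1) poly_eq_0_iff_dvd by (metis dvdE)
  have V': "poly (pderiv P) u = poly V u"
    by (simp add: V pderiv_mult pderiv_pCons del: mult_pCons_left)
  define A where "A = {z. poly V z \<noteq> 0}"
  have "open A" unfolding A_def by (intro open_Collect_neq continuous_intros)
  moreover have "(\<lambda>z. poly S z / poly V z) holomorphic_on A"
    by (intro holomorphic_intros) (auto simp: A_def)
  moreover have "u \<in> A" using assms(2) V' by (simp add: A_def)
  ultimately have "residue (\<lambda>z. poly S z / poly V z / (z - u)) u = poly S u / poly V u"
    by (intro residue_simple[of A])
  moreover have "(\<lambda>z. poly S z / poly P z) = (\<lambda>z. poly S z / poly V z / (z - u))"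
    by (simp add: V fun_eq_iff algebra_simps)
  ultimately show ?thesis by (simp add: V')
qed

text \<open>The residue theorem on the circle of radius \<open>\<rho>\<close>: roots outside have
  winding number 0, and the \<open>2 * pi\<close> in the circumference cancels that of the
  theorem.\<close>

lemma sum_residues_poly_quotient_bound:
  fixes S P :: "complex poly"
  assumes \<rho>: "\<rho> > 0" and B: "B \<ge> 0"
    and nz: "\<And>u. cmod u = \<rho> \<Longrightarrow> poly P u \<noteq> 0"
    and bound: "\<And>u. cmod u = \<rho> \<Longrightarrow> cmod (poly S u / poly P u) \<le> B"
    and simple: "\<And>u. poly P u = 0 \<Longrightarrow> cmod u < \<rho> \<Longrightarrow> poly (pderiv P) u \<noteq> 0"
  shows "cmod (\<Sum>u | poly P u = 0 \<and> cmod u < \<rho>. poly S u / poly (pderiv P) u) \<le> B * \<rho>"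
proof -
  define f where "f = (\<lambda>z. poly S z / poly P z)"
  define pts where "pts = {u. poly P u = 0}"
  have "P \<noteq> 0" using nz[of "of_real \<rho>"] \<rho> by auto
  hence fin: "finite pts" unfolding pts_def by (rule poly_roots_finite)
  have holo: "f holomorphic_on UNIV - pts"
    unfolding f_def by (intro holomorphic_intros) (auto simp: pts_def)
  have path: "path_image (circlepath 0 \<rho>) \<subseteq> UNIV - pts"
    using \<rho> nz by (auto simp: pts_def)
  have "contour_integral (circlepath 0 \<rho>) f
      = 2 * pi * \<i> * (\<Sum>u\<in>pts. winding_number (circlepath 0 \<rho>) u * residue f u)"
    by (rule Residue_theorem[of UNIV pts f "circlepath 0 \<rho>"]) (use fin holo path in auto)
  also have "(\<Sum>u\<in>pts. winding_number (circlepath 0 \<rho>) u * residue f u)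
      = (\<Sum>u\<in>pts. if cmod u < \<rho> then poly S u / poly (pderiv P) u else 0)"
  proof (intro sum.cong refl)
    fix u assume u: "u \<in> pts"
    hence "cmod u \<noteq> \<rho>" using nz by (auto simp: pts_def)
    then consider "cmod u < \<rho>" | "cmod u > \<rho>" by linarith
    thus "winding_number (circlepath 0 \<rho>) u * residue f u
        = (if cmod u < \<rho> then poly S u / poly (pderiv P) u else 0)"
    proof cases
      case 1
      thus ?thesis unfolding f_def
        using u simple by (simp add: winding_number_circlepath residue_poly_quotient pts_def)
    next
      case 2
      have "winding_number (circlepath 0 \<rho>) u = 0"
        by (rule winding_number_zero_outside[of _ "cball 0 \<rho>"]) (use 2 \<rho> in auto)
      thus ?thesis using 2 by simp
    qed
  qed
  also have "\<dots> = (\<Sum>u | poly P u = 0 \<and> cmod u < \<rho>. poly S u / poly (pderiv P) u)"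
    using fin by (simp add: sum.If_cases pts_def Int_def)
  finally have int: "contour_integral (circlepath 0 \<rho>) f
     = 2 * pi * \<i> * (\<Sum>u | poly P u = 0 \<and> cmod u < \<rho>. poly S u / poly (pderiv P) u)" .
  have "f contour_integrable_on circlepath 0 \<rho>"
    by (rule contour_integrable_continuous_circlepath)
      (intro holomorphic_on_imp_continuous_on holomorphic_on_subset[OF holo path])
  hence "cmod (contour_integral (circlepath 0 \<rho>) f) \<le> B * (2 * pi * \<rho>)"
    using \<rho> B bound
    by (intro has_contour_integral_bound_circlepath[OF has_contour_integral_integral]) (auto simp: f_def)
  thus ?thesis unfolding int by (simp add: norm_mult field_simps)
qed

section \<open>Passage to the upper half plane\<close>

lemma cmod_cayley_real: "cmod (cayley (of_real x)) = 1"
proof -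
  have "cmod (1 + \<i> * of_real x) = cmod (1 - \<i> * of_real x)" by (simp add: cmod_def)
  moreover have "1 - \<i> * of_real x \<noteq> 0" by (auto simp: complex_eq_iff)
  ultimately show ?thesis by (simp add: cayley_def norm_divide)
qed

lemma cayley_real_near_1:
  assumes "0 < x" "x \<le> 1"
  shows "x \<le> cmod (1 - cayley (of_real x))" "cmod (1 - cayley (of_real x)) \<le> 2 * x"
proof -
  have nz: "1 - \<i> * of_real x \<noteq> 0" by (auto simp: complex_eq_iff)
  have "1 - cayley (of_real x) = - 2 * \<i> * of_real x / (1 - \<i> * of_real x)"
    using nz by (simp add: cayley_def field_simps)
  hence e: "cmod (1 - cayley (of_real x)) = 2 * x / cmod (1 - \<i> * of_real x)"
    using assms by (simp add: norm_divide norm_mult)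
  have "cmod (1 - \<i> * of_real x) \<le> 1 + x"
    using norm_triangle_ineq4[of 1 "\<i> * of_real x"] assms by (simp add: norm_mult)
  hence 2: "cmod (1 - \<i> * of_real x) \<le> 2" using assms by linarith
  have 1: "cmod (1 - \<i> * of_real x) \<ge> 1"
    using abs_Re_le_cmod[of "1 - \<i> * of_real x"] by simp
  show "x \<le> cmod (1 - cayley (of_real x))"
    unfolding e using 1 2 assms by (simp add: pos_le_divide_eq)
  show "cmod (1 - cayley (of_real x)) \<le> 2 * x"
    unfolding e using 1 assms by (simp add: divide_le_eq)
qed

lemma cayley_imag:
  assumes "t > 0"
  shows "cmod (cayley (\<i> * of_real t)) < 1" "1 - \<i> * (\<i> * of_real t) \<noteq> 0"
proof -
  have e: "1 - \<i> * (\<i> * of_real t) = of_real (1 + t)" "1 + \<i> * (\<i> * of_real t) = of_real (1 - t)"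
    by (simp_all flip: mult.assoc)
  show "1 - \<i> * (\<i> * of_real t) \<noteq> 0" unfolding e using assms by (simp only: of_real_eq_0_iff)
  show "cmod (cayley (\<i> * of_real t)) < 1"
    unfolding cayley_def e norm_divide norm_of_real using assms by simp
qed

lemma Im_eq_0_if_cmod_cayley_eq_1:
  assumes "cmod (cayley w) = 1"
  shows "Im w = 0" "1 + \<i> * w \<noteq> 0"
proof -
  have "1 - \<i> * w \<noteq> 0" using assms by (auto simp: cayley_def)
  hence e: "cmod (1 + \<i> * w) = cmod (1 - \<i> * w)" using assms by (simp add: cayley_def norm_divide)
  hence "(cmod (1 + \<i> * w))\<^sup>2 = (cmod (1 - \<i> * w))\<^sup>2" by simp
  thus "Im w = 0" unfolding cmod_power2 by (simp add: power2_eq_square algebra_simps)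
  show "1 + \<i> * w \<noteq> 0" using e \<open>1 - \<i> * w \<noteq> 0\<close> by auto
qed

lemma DERIV_cayley:
  assumes "1 - \<i> * w \<noteq> 0"
  shows "(cayley has_field_derivative (2 * \<i> / (1 - \<i> * w)\<^sup>2)) (at w)"
  unfolding cayley_def
  by (rule derivative_eq_intros refl assms | simp)+ (use assms in \<open>simp add: field_simps power2_eq_square\<close>)

text \<open>Up to the common factor \<open>(1 - \<i> w1)^m (1 - \<i> w2)^n\<close> these are \<open>p + p~\<close> and \<open>\<i> (p - p~)\<close> in
  half-plane coordinates, so that \<open>g\<close> is \<open>hdiff / hsum\<close>.\<close>

definition hsum :: "(nat \<Rightarrow> nat \<Rightarrow> complex) \<Rightarrow> nat \<Rightarrow> nat \<Rightarrow> complex \<Rightarrow> complex \<Rightarrow> complex poly poly" where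
  "hsum c m n t1 t2 = halfplane_poly c m n t1 t2 + halfplane_poly (refl_coeffs c m n) m n t1 t2"

definition hdiff :: "(nat \<Rightarrow> nat \<Rightarrow> complex) \<Rightarrow> nat \<Rightarrow> nat \<Rightarrow> complex \<Rightarrow> complex \<Rightarrow> complex poly poly" where
  "hdiff c m n t1 t2 = smult [:\<i>:] (halfplane_poly c m n t1 t2 - halfplane_poly (refl_coeffs c m n) m n t1 t2)"

lemma eval2_hsum_hdiff:
  assumes "1 - \<i> * w1 \<noteq> 0" "1 - \<i> * w2 \<noteq> 0"
  shows "eval2 (hsum c m n t1 t2) w1 w2 = (1 - \<i> * w1) ^ m * (1 - \<i> * w2) ^ n *
      (bipoly c m n (t1 * cayley w1) (t2 * cayley w2) + refl_bipoly c m n (t1 * cayley w1) (t2 * cayley w2))"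
    and "eval2 (hdiff c m n t1 t2) w1 w2 = \<i> * ((1 - \<i> * w1) ^ m * (1 - \<i> * w2) ^ n *
      (bipoly c m n (t1 * cayley w1) (t2 * cayley w2) - refl_bipoly c m n (t1 * cayley w1) (t2 * cayley w2)))"
  unfolding hsum_def hdiff_def eval2_simps eval2_halfplane_poly[OF assms] bipoly_refl_coeffs
  by (simp_all add: algebra_simps)

text \<open>On the rays \<open>(\<i> * a * s, \<i> * s)\<close> the remainder has size
  \<open>s ^ L\<close> times a cofactor, and the hypothesis bounds it by a multiple of
  \<open>s ^ (M + k)\<close>. If \<open>L < M + k\<close>, division by \<open>s ^ L\<close> and
  \<open>s\<close> tending to 0 would make the cofactor vanish at a slope where it does not.\<close>

lemma remainder_blow_up:
  fixes P Q R H :: "complex poly poly" and C \<delta> :: real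
  assumes H: "\<And>u x. eval2 P (u * x) x = x ^ M * eval2 H u x" "slice H 0 \<noteq> 0" and \<delta>: "\<delta> > 0"
    and approx: "\<And>a s. 1 \<le> a \<Longrightarrow> a \<le> 2 \<Longrightarrow> 0 < s \<Longrightarrow> s < \<delta> \<Longrightarrow>
      eval2 P (\<i> * of_real (a * s)) (\<i> * of_real s) \<noteq> 0 \<Longrightarrow>
      cmod (eval2 Q (\<i> * of_real (a * s)) (\<i> * of_real s) / eval2 P (\<i> * of_real (a * s)) (\<i> * of_real s)
        - eval2 R (\<i> * of_real (a * s)) (\<i> * of_real s)) \<le> C * s ^ k"
  shows "\<exists>S. \<forall>u x. eval2 (Q - R * P) (u * x) x = x ^ (M + k) * eval2 S u x"
proof (cases "Q - R * P = 0")
  case True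
  thus ?thesis by (intro exI[of _ 0]) (simp del: eval2_simps(4))
next
  case False
  then obtain L T where T: "\<And>u x. eval2 (Q - R * P) (u * x) x = x ^ L * eval2 T u x" "slice T 0 \<noteq> 0"
    by (rule blow_up) blast
  show ?thesis
  proof (cases "M + k \<le> L")
    case True
    have "x ^ L = x ^ (M + k) * x ^ (L - (M + k))" for x :: complex using True by (simp flip: power_add)
    thus ?thesis
      by (intro exI[of _ "smult ([:0, 1:] ^ (L - (M + k))) T"]) (simp add: T(1) mult.assoc del: eval2_simps(4))
  next
    case False
    \<comment> \<open>Only finitely many slopes are roots of one of the two lowest homogeneous
      parts, so some real \<open>a\<close> between 1 and 2 avoids them all.\<close>
    define F where "F = {u. poly (slice H 0) u = 0} \<union> {u. poly (slice T 0) u = 0}"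
    have "finite F" unfolding F_def using poly_roots_finite H(2) T(2) by blast
    moreover have "infinite (complex_of_real ` {1..2})"
      by (subst finite_image_iff) (auto simp: inj_on_def infinite_Icc)
    ultimately have "\<not> complex_of_real ` {1..2} \<subseteq> F" using finite_subset by blast
    then obtain a where "a \<in> {1..2}" "of_real a \<notin> F" by blast
    hence a: "1 \<le> a" "a \<le> 2" "of_real a \<notin> F" by simp_all
    define f where "f = (\<lambda>s::real. cmod (eval2 T (of_real a) (\<i> * of_real s)))"
    define g where "g = (\<lambda>s::real. C * s ^ (M + k - L) * cmod (eval2 H (of_real a) (\<i> * of_real s)))"
    have lim0: "(\<phi> \<longlongrightarrow> \<phi> 0) (at_right 0)" if "continuous_on UNIV \<phi>" for \<phi> :: "real \<Rightarrow> real"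
      using that by (simp add: continuous_on_eq_continuous_at continuous_at_imp_continuous_at_within flip: continuous_within)
    have f: "(f \<longlongrightarrow> f 0) (at_right 0)" and g: "(g \<longlongrightarrow> g 0) (at_right 0)"
      unfolding f_def g_def by (intro lim0 continuous_intros)+
    have h: "((\<lambda>s. cmod (eval2 H (of_real a) (\<i> * of_real s))) \<longlongrightarrow> cmod (eval2 H (of_real a) (\<i> * of_real 0))) (at_right 0)"
      by (intro lim0[of "\<lambda>s. cmod (eval2 H (of_real a) (\<i> * of_real s))"] continuous_intros)
    have H0: "cmod (eval2 H (of_real a) (\<i> * of_real 0)) > 0" and f0: "f 0 > 0"
      using a(3) by (auto simp: F_def f_def)
    have "eventually (\<lambda>s. cmod (eval2 H (of_real a) (\<i> * of_real s)) > 0) (at_right 0)"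
      using order_tendstoD(1)[OF h H0] .
    moreover have "eventually (\<lambda>s::real. 0 < s \<and> s < \<delta>) (at_right 0)"
      using \<delta> eventually_at_right_field by blast
    ultimately have "eventually (\<lambda>s. f s \<le> g s) (at_right 0)"
    proof eventually_elim
      case (elim s)
      define x where "x = \<i> * complex_of_real s"
      have x: "x \<noteq> 0" "cmod x = s" using elim by (auto simp: x_def norm_mult)
      have ax: "\<i> * of_real (a * s) = of_real a * x" by (simp add: x_def)
      have P0: "eval2 P (of_real a * x) x \<noteq> 0" using elim x by (simp add: H(1) x_def)
      have "cmod (eval2 Q (of_real a * x) x / eval2 P (of_real a * x) x - eval2 R (of_real a * x) x) \<le> C * s ^ k"
        using approx[of a s] a elim P0 unfolding ax x_def[symmetric] by blast
      hence "cmod (eval2 Q (of_real a * x) x / eval2 P (of_real a * x) x - eval2 R (of_real a * x) x)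
          * cmod (eval2 P (of_real a * x) x) \<le> C * s ^ k * cmod (eval2 P (of_real a * x) x)"
        by (rule mult_right_mono) simp
      also have "cmod (eval2 Q (of_real a * x) x / eval2 P (of_real a * x) x - eval2 R (of_real a * x) x)
          * cmod (eval2 P (of_real a * x) x) = cmod (eval2 (Q - R * P) (of_real a * x) x)"
        using P0 by (simp add: norm_mult[symmetric] left_diff_distrib)
      also have "\<dots> = s ^ L * f s" by (simp add: T(1) norm_mult norm_power x f_def x_def[symmetric] del: eval2_simps(4))
      also have "C * s ^ k * cmod (eval2 P (of_real a * x) x)
          = C * s ^ k * s ^ M * cmod (eval2 H (of_real a) x)"
        by (simp add: H(1) norm_mult norm_power x)
      also have "\<dots> = C * (s ^ L * s ^ (M + k - L)) * cmod (eval2 H (of_real a) x)"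
        using False by (simp flip: power_add add: add.commute mult.assoc)
      also have "\<dots> = s ^ L * g s" by (simp add: g_def x_def)
      finally show ?case using elim by simp
    qed
    hence "f 0 \<le> g 0" using f g by (intro tendsto_le[OF _ g f]) auto
    moreover have "g 0 = 0" using False by (simp add: g_def zero_power)
    ultimately show ?thesis using f0 by simp
  qed
qed

section \<open>The contact order at a singularity\<close>

context stable_atoral
begin

lemma finite_sing_coordinates: "finite (snd ` sing c m n)"
proof -
  obtain X where "finite X" "snd ` sing c m n \<subseteq> X" by (rule eps1_rational) blast
  thus ?thesis by (rule rev_finite_subset)
qed

lemma regular_near_singularity:
  assumes "cmod \<tau>2 = 1"
  obtains \<eta> where "\<eta> > 0" "\<eta> \<le> 1"
    "\<And>x. 0 < x \<Longrightarrow> x < \<eta> \<Longrightarrow> \<tau>2 * cayley (of_real x) \<notin> snd ` sing c m n"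
proof -
  obtain d where d: "d > 0" "\<And>y. y \<in> snd ` sing c m n \<Longrightarrow> y \<noteq> \<tau>2 \<Longrightarrow> d \<le> dist \<tau>2 y"
    using finite_set_avoid[OF finite_sing_coordinates, of \<tau>2] by blast
  show ?thesis
  proof (rule that[of "min 1 (d / 2)"])
    fix x assume x: "0 < x" "x < min 1 (d / 2)"
    have "\<tau>2 - \<tau>2 * cayley (of_real x) = \<tau>2 * (1 - cayley (of_real x))" by (simp add: algebra_simps)
    hence "cmod (\<tau>2 - \<tau>2 * cayley (of_real x)) = cmod (1 - cayley (of_real x))"
      using assms by (simp add: norm_mult)
    hence "0 < cmod (\<tau>2 - \<tau>2 * cayley (of_real x))" "cmod (\<tau>2 - \<tau>2 * cayley (of_real x)) < d"
      using cayley_real_near_1[of x] x by auto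
    thus "\<tau>2 * cayley (of_real x) \<notin> snd ` sing c m n"
      using d(2)[of "\<tau>2 * cayley (of_real x)"] by (auto simp: dist_norm)
  qed (use d in auto)
qed

text \<open>At a regular \<open>\<zeta>\<close> the Blaschke product has modulus below 1 at the
  centre of the disc, which corresponds to \<open>w1 = \<i>\<close>. So \<open>p + p~\<close> cannot
  vanish there.\<close>

lemma hsum_nonzero:
  assumes "cmod \<tau>2 = 1"
  shows "hsum c m n \<tau>1 \<tau>2 \<noteq> 0"
proof
  assume 0: "hsum c m n \<tau>1 \<tau>2 = 0"
  obtain \<eta> where \<eta>: "\<eta> > 0" "\<And>x. 0 < x \<Longrightarrow> x < \<eta> \<Longrightarrow> \<tau>2 * cayley (of_real x) \<notin> snd ` sing c m n"
    by (rule regular_near_singularity[OF assms]) blast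
  define x where "x = \<eta> / 2"
  have x: "0 < x" "x < \<eta>" using \<eta>(1) by (simp_all add: x_def)
  define \<zeta> where "\<zeta> = \<tau>2 * cayley (of_real x)"
  have \<zeta>: "cmod \<zeta> = 1" "\<zeta> \<notin> snd ` sing c m n"
    using \<eta>(2)[OF x] assms by (simp_all add: \<zeta>_def norm_mult cmod_cayley_real)
  obtain a C C' where b: "blaschke m a C C'" "slice RR \<zeta> = blaschke.num m a C"
    "slice PP \<zeta> = blaschke.den m a C'" by (rule blaschke_slice[OF \<zeta>])
  interpret blaschke m a C C' by fact
  have nz: "1 - \<i> * of_real x \<noteq> 0" by (auto simp: complex_eq_iff)
  have "cayley \<i> = 0" "1 - \<i> * \<i> \<noteq> 0" by (simp_all add: cayley_def)
  hence "p 0 \<zeta> + q 0 \<zeta> = 0"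
    using eval2_hsum_hdiff(1)[of \<i> "of_real x" c m n \<tau>1 \<tau>2] nz 0 by (simp add: \<zeta>_def)
  hence "poly (slice PP \<zeta>) 0 = - poly (slice RR \<zeta>) 0" by (simp add: add_eq_0_iff2)
  hence "cmod (poly den 0) = cmod (poly num 0)" unfolding b by simp
  thus False using cmod_num_den(1)[of 0] by simp
qed

text \<open>At a zero of \<open>hsum\<close> one has \<open>\<phi> = -1\<close>. The numerator
  \<open>hdiff\<close> is then \<open>- 2 * \<i> * E * y\<close>, and the derivative of
  \<open>hsum\<close> is a multiple of \<open>E * h * y\<close>, so \<open>E\<close> and
  \<open>y\<close> cancel in the residue and a real negative number remains.\<close>

lemma residue_at_root:
  fixes x :: real and u :: complex
  assumes \<tau>: "cmod \<tau>1 = 1" "cmod \<tau>2 = 1" and "J > 0"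
    and H: "\<And>u x. eval2 (hsum c m n \<tau>1 \<tau>2) (u * x) x = x ^ M * eval2 H u x"
    and S: "\<And>u x. eval2 (hdiff c m n \<tau>1 \<tau>2 - R * hsum c m n \<tau>1 \<tau>2) (u * x) x
               = x ^ (M + (2 * J - 1)) * eval2 S u x"
    and x: "0 < x" "\<tau>2 * cayley (of_real x) \<notin> snd ` sing c m n"
    and u: "eval2 H u (of_real x) = 0" "cmod (u * of_real x) < 1"
  shows "\<exists>h>0. eps1 c m n (\<tau>2 * cayley (of_real x)) \<le> 2 * real m / h \<and>
    poly (pderiv (slice H (of_real x))) u \<noteq> 0 \<and>
    eval2 S u (of_real x) / poly (pderiv (slice H (of_real x))) u
      = - of_real ((1 + (Re (u * of_real x))\<^sup>2) / (h * x ^ (2 * J)))"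
proof -
  define X where "X = complex_of_real x"
  define \<zeta> where "\<zeta> = \<tau>2 * cayley X"
  define w where "w = u * X"
  define z where "z = \<tau>1 * cayley w"
  have X0: "X \<noteq> 0" using x by (simp add: X_def)
  have \<zeta>: "cmod \<zeta> = 1" "\<zeta> \<notin> snd ` sing c m n"
    using \<tau> x by (auto simp: \<zeta>_def X_def norm_mult cmod_cayley_real)
  obtain a C C' where b: "blaschke m a C C'" "slice RR \<zeta> = blaschke.num m a C"
    "slice PP \<zeta> = blaschke.den m a C'" and roots: "\<forall>z. q z \<zeta> = 0 \<longleftrightarrow> (\<exists>k<m. z = a k)"
    by (rule blaschke_slice[OF \<zeta>])
  interpret blaschke m a C C' by fact
  have q: "q v \<zeta> = poly num v" and p: "p v \<zeta> = poly den v" for v by (simp_all flip: b(2,3))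
  have nzX: "1 - \<i> * X \<noteq> 0" by (auto simp: complex_eq_iff X_def)
  \<comment> \<open>The bound on \<open>u * x\<close> keeps \<open>w\<close> away from the pole
    \<open>- \<i>\<close> of \<open>cayley\<close>.\<close>
  have nzw: "1 - \<i> * w \<noteq> 0"
  proof
    assume "1 - \<i> * w = 0"
    hence "cmod (\<i> * w) = 1" by (metis eq_iff_diff_eq_0 norm_one)
    thus False using u(2) by (simp add: norm_mult w_def X_def)
  qed
  define k1 where "k1 = (1 - \<i> * X) ^ n"
  define E where "E = (1 - \<i> * w) ^ m * k1"
  have E0: "E \<noteq> 0" using nzX nzw by (simp add: E_def k1_def)
  have hs: "eval2 (hsum c m n \<tau>1 \<tau>2) (v * X) X = (1 - \<i> * (v * X)) ^ m * k1 * poly (num + den) (\<tau>1 * cayley (v * X))"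
    if "1 - \<i> * (v * X) \<noteq> 0" for v
    using eval2_hsum_hdiff(1)[OF that nzX, of c m n \<tau>1 \<tau>2]
    by (simp add: k1_def \<zeta>_def[symmetric] p q add.commute)
  define y where "y = poly num z"
  have "eval2 (hsum c m n \<tau>1 \<tau>2) w X = 0" using H[of u X] u(1) by (simp add: w_def X_def)
  hence sum0: "poly (num + den) z = 0"
    using hs[of u] nzw E0 by (simp add: w_def[symmetric] z_def[symmetric] E_def)
  \<comment> \<open>Equality of the moduli of \<open>num\<close> and \<open>den\<close> places
    \<open>z\<close> on the circle, and then \<open>w\<close> on the real line.\<close>
  hence den: "poly den z = - y" by (simp add: y_def add_eq_0_iff)
  have z1: "cmod z = 1" by (rule unimodular_if_equal_cmod) (simp add: den y_def)
  hence cw: "cmod (cayley w) = 1" using \<tau> by (simp add: z_def norm_mult)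
  have w: "Im w = 0" "1 + \<i> * w \<noteq> 0" using Im_eq_0_if_cmod_cayley_eq_1[OF cw] by auto
  hence wr: "w = of_real (Re w)" by (simp add: complex_eq_iff)
  have y0: "y \<noteq> 0" using num_nonzero[of z] z1 by (simp add: y_def)
  define h where "h = poisson z"
  have h: "h > 0" using poisson_pos[OF z1] by (simp add: h_def)
  define s' where "s' = poly (pderiv num) z + poly (pderiv den) z"
  have "z * (poly (pderiv num) z / y - poly (pderiv den) z / (- y)) = of_real h"
    using log_derivative[OF z1] by (simp add: den y_def h_def)
  hence zs: "z * s' = of_real h * y" using y0 by (simp add: s'_def field_simps)
  define d where "d = poly (pderiv (slice H X)) u"
  have w2: "(1 - \<i> * w) * (1 + \<i> * w) = 1 + w\<^sup>2" by (simp add: algebra_simps power2_eq_square)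
  have w20: "1 + w\<^sup>2 \<noteq> 0" using w(2) nzw w2 by (metis mult_eq_0_iff)
  have d: "X ^ M * d = E * (of_real h * y) * (2 * \<i> * X / (1 + w\<^sup>2))"
  proof -
    have 1: "((\<lambda>v. eval2 (hsum c m n \<tau>1 \<tau>2) (v * X) X) has_field_derivative X ^ M * d) (at u)"
      unfolding H d_def unfolding poly_slice[symmetric] by (intro DERIV_cmult poly_DERIV)
    have c1: "((\<lambda>v. cayley (v * X)) has_field_derivative (2 * \<i> / (1 - \<i> * w)\<^sup>2 * X)) (at u)"
    proof (rule DERIV_chain2[of cayley])
      show "(cayley has_field_derivative 2 * \<i> / (1 - \<i> * w)\<^sup>2) (at (u * X))"
        using DERIV_cayley[OF nzw] by (simp add: w_def)
      show "((\<lambda>v. v * X) has_field_derivative X) (at u)"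
        by (auto intro!: derivative_eq_intros)
    qed
    have "poly (pderiv (num + den)) z = s'" by (simp add: s'_def pderiv_add)
    hence c2: "((\<lambda>v. poly (num + den) (\<tau>1 * cayley (v * X))) has_field_derivative
        (s' * (\<tau>1 * (2 * \<i> / (1 - \<i> * w)\<^sup>2 * X)))) (at u)"
      using DERIV_chain2[OF poly_DERIV[of "num + den" "\<tau>1 * cayley (u * X)"] DERIV_cmult[OF c1, of \<tau>1]]
      by (simp add: w_def[symmetric] z_def[symmetric])
    have "((\<lambda>v. (1 - \<i> * (v * X)) ^ m * k1) has_field_derivative
        (- (of_nat m * (1 - \<i> * w) ^ (m - 1) * (\<i> * X)) * k1)) (at u)"
      by (auto intro!: derivative_eq_intros simp: w_def)
    \<comment> \<open>The factor \<open>num + den\<close> vanishes at \<open>z\<close>, so only the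
      term in which it is differentiated survives.\<close>
    from DERIV_mult[OF this c2] sum0
    have 2: "((\<lambda>v. (1 - \<i> * (v * X)) ^ m * k1 * poly (num + den) (\<tau>1 * cayley (v * X))) has_field_derivative
        (s' * (\<tau>1 * (2 * \<i> / (1 - \<i> * w)\<^sup>2 * X)) * E)) (at u)"
      by (simp add: E_def w_def[symmetric] z_def[symmetric])
    have "open {v. 1 - \<i> * (v * X) \<noteq> 0}" by (intro open_Collect_neq continuous_intros)
    from has_field_derivative_transform_within_open[OF 2 this, of "\<lambda>v. eval2 (hsum c m n \<tau>1 \<tau>2) (v * X) X"]
    have "((\<lambda>v. eval2 (hsum c m n \<tau>1 \<tau>2) (v * X) X) has_field_derivative
        (s' * (\<tau>1 * (2 * \<i> / (1 - \<i> * w)\<^sup>2 * X)) * E)) (at u)"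
      using hs nzw by (simp add: w_def)
    hence "X ^ M * d = s' * (\<tau>1 * (2 * \<i> / (1 - \<i> * w)\<^sup>2 * X)) * E" using 1 DERIV_unique by blast
    also have "\<tau>1 * (2 * \<i> / (1 - \<i> * w)\<^sup>2 * X) = z * (2 * \<i> * X / (1 + w\<^sup>2))"
      unfolding z_def cayley_def w2[symmetric] using w(2) nzw by (simp add: power2_eq_square)
    also have "s' * (z * (2 * \<i> * X / (1 + w\<^sup>2))) * E = E * (z * s') * (2 * \<i> * X / (1 + w\<^sup>2))"
      by (simp add: mult_ac)
    finally show ?thesis unfolding zs .
  qed
  hence d0: "d \<noteq> 0" using E0 h y0 X0 w20 by auto
  have "X ^ (M + (2 * J - 1)) * eval2 S u X = eval2 (hdiff c m n \<tau>1 \<tau>2) w X"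
    using S[of u X] \<open>eval2 (hsum c m n \<tau>1 \<tau>2) w X = 0\<close> by (simp add: w_def)
  also have "\<dots> = \<i> * (E * (p z \<zeta> - q z \<zeta>))"
    using eval2_hsum_hdiff(2)[OF nzw nzX, of c m n \<tau>1 \<tau>2] by (simp add: E_def k1_def z_def \<zeta>_def)
  also have "\<dots> = - (2 * \<i> * E * y)" unfolding p q den by (simp add: y_def)
  finally have S': "X ^ (M + (2 * J - 1)) * eval2 S u X = - (2 * \<i> * E * y)" .
  \<comment> \<open>One factor \<open>X\<close> comes from the chain rule for
    \<open>w = u * X\<close>, the other \<open>2 * J - 1\<close> from the blow-up of the remainder.
    This is how the even exponent arises.\<close>
  have XJ: "X ^ (2 * J) = X ^ (2 * J - 1) * X" using \<open>J > 0\<close> by (simp flip: power_Suc2)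
  have "X ^ M * (eval2 S u X * (of_real h * X ^ (2 * J))) = - (X ^ M * d * (1 + w\<^sup>2))"
  proof -
    have "X ^ M * (eval2 S u X * (of_real h * X ^ (2 * J)))
        = (X ^ (M + (2 * J - 1)) * eval2 S u X) * (of_real h * X)"
      unfolding XJ power_add by (simp add: mult_ac)
    also have "\<dots> = - (E * (of_real h * y) * (2 * \<i> * X))" unfolding S' by (simp add: mult_ac)
    also have "E * (of_real h * y) * (2 * \<i> * X) = X ^ M * d * (1 + w\<^sup>2)" unfolding d using w20 by simp
    finally show ?thesis .
  qed
  hence "X ^ M * (eval2 S u X * (of_real h * X ^ (2 * J))) = X ^ M * (- (d * (1 + w\<^sup>2)))"
    by (simp add: mult_ac)
  hence "eval2 S u X * (of_real h * X ^ (2 * J)) = - (d * (1 + w\<^sup>2))"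
    using mult_left_cancel[OF power_not_zero[OF X0, of M]] by blast
  hence "eval2 S u X / d = - ((1 + w\<^sup>2) / (of_real h * X ^ (2 * J)))"
    using d0 X0 h by (simp add: field_simps)
  also have "(1 + w\<^sup>2) / (of_real h * X ^ (2 * J)) = of_real ((1 + (Re w)\<^sup>2) / (h * x ^ (2 * J)))"
    by (subst wr) (simp add: X_def)
  finally have Sd: "eval2 S u X / d = - of_real ((1 + (Re w)\<^sup>2) / (h * x ^ (2 * J)))" .
  have "eps1 c m n \<zeta> \<le> 2 * real m / h"
  proof -
    obtain k where k: "k < m" "eps1 c m n \<zeta> = 1 - cmod (a k)"
      using eps1_bounds(1)[OF \<zeta> roots] by auto
    hence e: "eps1 c m n \<zeta> > 0" using a by simp
    have "h \<le> 2 * real m / eps1 c m n \<zeta>"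
      unfolding h_def using eps1_bounds(2)[OF \<zeta> roots] by (intro poisson_le[OF z1 e])
    thus ?thesis using e h by (simp add: field_simps)
  qed
  thus ?thesis using h d0 Sd unfolding d_def \<zeta>_def w_def X_def by blast
qed

end

section \<open>The contour estimate for the contact order\<close>

context stable_atoral
begin

lemma gfun_rif_eq:
  assumes \<tau>: "cmod \<tau>1 = 1" "cmod \<tau>2 = 1" and ab: "a > 0" "b > 0"
    and nz0: "eval2 (hsum c m n \<tau>1 \<tau>2) (\<i> * of_real a) (\<i> * of_real b) \<noteq> 0"
  shows "gfun (rif c m n) \<tau>1 \<tau>2 (\<i> * of_real a) (\<i> * of_real b)
    = eval2 (hdiff c m n \<tau>1 \<tau>2) (\<i> * of_real a) (\<i> * of_real b)
      / eval2 (hsum c m n \<tau>1 \<tau>2) (\<i> * of_real a) (\<i> * of_real b)"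
proof -
  let ?z = "\<tau>1 * cayley (\<i> * of_real a)" and ?w = "\<tau>2 * cayley (\<i> * of_real b)"
  note A = cayley_imag[OF ab(1)] and B = cayley_imag[OF ab(2)]
  have p0: "p ?z ?w \<noteq> 0" by (rule nz) (use \<tau> A B in \<open>auto simp: norm_mult\<close>)
  have pq: "p ?z ?w + q ?z ?w \<noteq> 0" using nz0 unfolding eval2_hsum_hdiff(1)[OF A(2) B(2)] by auto
  have "gfun (rif c m n) \<tau>1 \<tau>2 (\<i> * of_real a) (\<i> * of_real b)
      = \<i> * (p ?z ?w - q ?z ?w) / (p ?z ?w + q ?z ?w)"
    unfolding gfun_def rif_def using p0 pq by (simp add: field_simps)
  also have "\<dots> = eval2 (hdiff c m n \<tau>1 \<tau>2) (\<i> * of_real a) (\<i> * of_real b)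
      / eval2 (hsum c m n \<tau>1 \<tau>2) (\<i> * of_real a) (\<i> * of_real b)"
    unfolding eval2_hsum_hdiff[OF A(2) B(2)] using A(2) B(2) by simp
  finally show ?thesis .
qed

text \<open>In the coordinate \<open>u = w1 / x\<close> the circle has a fixed radius, and
  \<open>S / H\<close> is bounded on it uniformly in small \<open>x\<close>. Positive degree of the
  lowest part supplies a root \<open>u0\<close> at \<open>x = 0\<close>, hence a pole inside the
  circle for suitable small \<open>x\<close>.\<close>

lemma K1_ge_of_expansion:
  fixes C \<delta> :: real
  assumes \<tau>: "(\<tau>1, \<tau>2) \<in> sing c m n" and J: "J > 0" and \<delta>: "\<delta> > 0"
    and expansion: "\<And>a b s. 1 \<le> a \<Longrightarrow> a \<le> 2 \<Longrightarrow> 1 \<le> b \<Longrightarrow> b \<le> 2 \<Longrightarrow> 0 < s \<Longrightarrow> s < \<delta> \<Longrightarrow>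
      cmod (gfun (rif c m n) \<tau>1 \<tau>2 (\<i> * of_real (a * s)) (\<i> * of_real (b * s))
        - eval2 R (\<i> * of_real (a * s)) (\<i> * of_real (b * s))) \<le> C * s ^ (2 * J - 1)"
    and H: "\<And>u x. eval2 (hsum c m n \<tau>1 \<tau>2) (u * x) x = x ^ M * eval2 H u x" "slice H 0 \<noteq> 0"
    and deg: "degree (slice H 0) > 0"
  shows "K1 c m n \<ge> 2 * real J"
proof -
  have \<tau>': "cmod \<tau>1 = 1" "cmod \<tau>2 = 1" using \<tau> by (auto simp: sing_def)
  define P where "P = hsum c m n \<tau>1 \<tau>2"
  define Q where "Q = hdiff c m n \<tau>1 \<tau>2"
  obtain S where S: "\<And>u x. eval2 (Q - R * P) (u * x) x = x ^ (M + (2 * J - 1)) * eval2 S u x"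
  proof -
    have "\<exists>S. \<forall>u x. eval2 (Q - R * P) (u * x) x = x ^ (M + (2 * J - 1)) * eval2 S u x"
    proof (rule remainder_blow_up[OF H[folded P_def] \<delta>])
      fix a s :: real assume as: "1 \<le> a" "a \<le> 2" "0 < s" "s < \<delta>"
        "eval2 P (\<i> * of_real (a * s)) (\<i> * of_real s) \<noteq> 0"
      show "cmod (eval2 Q (\<i> * of_real (a * s)) (\<i> * of_real s) / eval2 P (\<i> * of_real (a * s)) (\<i> * of_real s)
        - eval2 R (\<i> * of_real (a * s)) (\<i> * of_real s)) \<le> C * s ^ (2 * J - 1)"
        using expansion[of a 1 s] gfun_rif_eq[OF \<tau>', of "a * s" s] as
        unfolding P_def Q_def by simp
    qed
    thus ?thesis using that by blast
  qed
  obtain u0 where u0: "poly (slice H 0) u0 = 0"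
    using deg fundamental_theorem_of_algebra_alt[of "slice H 0"] by (metis degree_pCons_0 less_irrefl)
  have "finite (cmod ` {u. poly (slice H 0) u = 0})"
    using poly_roots_finite[OF H(2)] by (rule finite_imageI)
  moreover have "infinite {cmod u0<..}" by (rule infinite_Ioi)
  ultimately have "\<not> {cmod u0<..} \<subseteq> cmod ` {u. poly (slice H 0) u = 0}" using finite_subset by blast
  \<comment> \<open>The radius exceeds \<open>cmod u0\<close> and avoids the moduli of the finitely
    many roots of the lowest part.\<close>
  then obtain \<rho> where \<rho>u: "\<rho> \<in> {cmod u0<..}" and "\<rho> \<notin> cmod ` {u. poly (slice H 0) u = 0}" by blast
  hence circ: "\<And>u. cmod u = \<rho> \<Longrightarrow> eval2 H u 0 \<noteq> 0" by force
  have "cmod u0 < \<rho>" using \<rho>u by simp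
  hence \<rho>: "\<rho> > 0" "cmod u0 < \<rho>" using le_less_trans[OF norm_ge_zero] by auto
  let ?K = "sphere (0::complex) \<rho>"
  have K: "compact ?K" "?K \<noteq> {}" using \<rho> by auto
  obtain \<kappa> where \<kappa>: "\<kappa> > 0" "\<And>u. cmod u = \<rho> \<Longrightarrow> \<kappa> \<le> cmod (eval2 H u 0)"
  proof -
    have "continuous_on ?K (\<lambda>u. cmod (eval2 H u 0))" by (intro continuous_intros)
    then obtain v where "v \<in> ?K" "\<And>u. u \<in> ?K \<Longrightarrow> cmod (eval2 H v 0) \<le> cmod (eval2 H u 0)"
      using continuous_attains_inf[OF K] by blast
    thus ?thesis using circ[of v] by (intro that[of "cmod (eval2 H v 0)"]) auto
  qed
  obtain \<eta>1 where \<eta>1: "\<eta>1 > 0" "\<And>u x. cmod u = \<rho> \<Longrightarrow> cmod x < \<eta>1 \<Longrightarrow> cmod (eval2 H u x - eval2 H u 0) \<le> \<kappa> / 2"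
    using eval2_equicontinuous[OF K(1) half_gt_zero[OF \<kappa>(1)], of 0 H] by (auto simp: dist_norm)
  obtain B1 where B1: "B1 > 0" "\<And>u x. cmod u = \<rho> \<Longrightarrow> cmod x \<le> 1 \<Longrightarrow> cmod (eval2 S u x) \<le> B1"
  proof -
    have "compact ((\<lambda>x. eval2 S (fst x) (snd x)) ` (?K \<times> cball 0 1))"
      by (intro compact_continuous_image continuous_intros compact_Times K compact_cball)
    then obtain B where B: "B > 0" "\<And>x. x \<in> (\<lambda>x. eval2 S (fst x) (snd x)) ` (?K \<times> cball 0 1) \<Longrightarrow> cmod x \<le> B"
      using compact_imp_bounded bounded_pos by metis
    show ?thesis
    proof (rule that[OF B(1)])
      fix u x :: complex assume "cmod u = \<rho>" "cmod x \<le> 1"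
      thus "cmod (eval2 S u x) \<le> B" by (intro B(2) image_eqI[of _ _ "(u, x)"]) auto
    qed
  qed
  define B where "B = B1 / (\<kappa> / 2)"
  have B: "B > 0" using B1 \<kappa> by (simp add: B_def)
  obtain \<eta>2 where \<eta>2: "\<eta>2 > 0" "\<eta>2 \<le> 1" "\<And>x. 0 < x \<Longrightarrow> x < \<eta>2 \<Longrightarrow> \<tau>2 * cayley (of_real x) \<notin> snd ` sing c m n"
    by (rule regular_near_singularity[OF \<tau>'(2)]) blast
  show ?thesis
  proof (rule K1_ge[OF \<tau>, of "2 * real J" "2 * real m * (B * \<rho>)"])
    show "2 * real J > 0" using J by simp
    fix d :: real assume "d > 0"
    \<comment> \<open>The bound by \<open>\<eta>1\<close> keeps \<open>H\<close> at least
      \<open>\<kappa> / 2\<close> in modulus on the circle, the one by \<open>\<eta>2\<close> avoids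
      other singular coordinates, \<open>1 / \<rho>\<close> ensures \<open>cmod (u * x) < 1\<close>,
      and \<open>d / 2\<close> matches \<open>cmod (\<tau>2 - \<zeta>) <= 2 * x\<close>.\<close>
    define \<eta> where "\<eta> = min (min \<eta>1 \<eta>2) (min (1 / \<rho>) (d / 2))"
    have \<eta>: "\<eta> > 0" "\<eta> \<le> \<eta>1" "\<eta> \<le> \<eta>2" "\<eta> \<le> 1 / \<rho>" "\<eta> \<le> d / 2"
      using \<eta>1(1) \<eta>2(1) \<rho>(1) \<open>d > 0\<close> by (auto simp: \<eta>_def)
    have lim: "(\<lambda>k. complex_of_real (\<eta> / real (k + 2))) \<longlonglongrightarrow> of_real 0"
      by (intro tendsto_of_real LIMSEQ_ignore_initial_segment lim_const_over_n)
    have nonconst: "\<not> (\<lambda>z. eval2 H z 0) constant_on ball 0 \<rho>"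
    proof
      assume "(\<lambda>z. eval2 H z 0) constant_on ball 0 \<rho>"
      then obtain k where k: "\<And>z. z \<in> ball 0 \<rho> \<Longrightarrow> eval2 H z 0 = k" unfolding constant_on_def by blast
      have "ball 0 \<rho> \<subseteq> {z. poly (slice H 0 - [:k:]) z = 0}" using k by auto
      moreover have "slice H 0 - [:k:] \<noteq> 0" using deg by auto
      hence "finite {z. poly (slice H 0 - [:k:]) z = 0}" by (rule poly_roots_finite)
      ultimately have "finite (ball (0::complex) \<rho>)" by (rule finite_subset)
      thus False using uncountable_ball[OF \<rho>(1)] countable_finite by blast
    qed
    \<comment> \<open>By Hurwitz, the root \<open>u0\<close> at \<open>x = 0\<close> forces a root
      in the same disc for some member of a sequence of positive \<open>x\<close> tending to
      0.\<close>
    obtain k us where k: "us \<in> ball 0 \<rho>" "eval2 H us (of_real (\<eta> / real (k + 2))) = 0"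
      using eval2_root_nearby[OF open_ball connected_ball _ _ nonconst lim[unfolded of_real_0], of u0] u0 \<rho>(2)
      by auto
    define x where "x = \<eta> / real (k + 2)"
    have x: "0 < x" "x < \<eta>" using \<eta>(1) by (auto simp: x_def field_simps intro: add_pos_nonneg)
    have "\<rho> * x < \<rho> * \<eta>" using x \<rho>(1) by simp
    also have "\<dots> \<le> 1" using \<eta>(4) \<rho>(1) by (simp add: field_simps)
    finally have x1: "x < 1" "x < \<eta>1" "x < \<eta>2" "\<rho> * x < 1" "2 * x < d"
      using x \<eta> \<eta>2(2) by auto
    define \<zeta> where "\<zeta> = \<tau>2 * cayley (of_real x)"
    have \<zeta>: "cmod \<zeta> = 1" using \<tau>' by (simp add: \<zeta>_def norm_mult cmod_cayley_real)
    have res: "\<exists>h>0. eps1 c m n \<zeta> \<le> 2 * real m / h \<and> poly (pderiv (slice H (of_real x))) u \<noteq> 0 \<and>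
        eval2 S u (of_real x) / poly (pderiv (slice H (of_real x))) u
          = - of_real ((1 + (Re (u * of_real x))\<^sup>2) / (h * x ^ (2 * J)))"
      if "eval2 H u (of_real x) = 0" "cmod u < \<rho>" for u
      unfolding \<zeta>_def
    proof (rule residue_at_root[OF \<tau>' J H(1) S[unfolded P_def Q_def] x(1) \<eta>2(3)[OF x(1) x1(3)] that(1)])
      have "cmod (u * of_real x) \<le> \<rho> * x" using that(2) x by (simp add: norm_mult)
      thus "cmod (u * of_real x) < 1" using x1 by linarith
    qed
    define Z where "Z = {u. poly (slice H (of_real x)) u = 0 \<and> cmod u < \<rho>}"
    define f where "f = (\<lambda>u. eval2 S u (of_real x) / poly (pderiv (slice H (of_real x))) u)"
    have circle_bound: "\<kappa> / 2 \<le> cmod (eval2 H u (of_real x))" if "cmod u = \<rho>" for u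
      using \<eta>1(2)[OF that, of "of_real x"] \<kappa>(2)[OF that] x x1
        norm_triangle_ineq2[of "eval2 H u 0" "eval2 H u 0 - eval2 H u (of_real x)"]
      by (simp add: norm_minus_commute)
    have sum_bound: "cmod (\<Sum>u\<in>Z. f u) \<le> B * \<rho>"
      unfolding Z_def f_def poly_slice[symmetric]
    proof (rule sum_residues_poly_quotient_bound[OF \<rho>(1)])
      show "0 \<le> B" using B by simp
      fix u :: complex
      show "poly (slice H (of_real x)) u \<noteq> 0" if "cmod u = \<rho>"
        using circle_bound[OF that] \<kappa>(1) by auto
      show "cmod (poly (slice S (of_real x)) u / poly (slice H (of_real x)) u) \<le> B" if "cmod u = \<rho>"
        unfolding B_def norm_divide poly_slice
        using circle_bound[OF that] \<kappa>(1) B1 that x x1 by (intro frac_le) auto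
      show "poly (pderiv (slice H (of_real x))) u \<noteq> 0" if "poly (slice H (of_real x)) u = 0" "cmod u < \<rho>"
        using res[of u] that by auto
    qed
    have "cmod us < \<rho>" "eval2 H us (of_real x) = 0" using k by (auto simp: x_def)
    hence us: "us \<in> Z" by (simp add: Z_def)
    obtain h where h: "h > 0" "eps1 c m n \<zeta> \<le> 2 * real m / h" "f us = - of_real ((1 + (Re (us * of_real x))\<^sup>2) / (h * x ^ (2 * J)))"
      using res[OF \<open>eval2 H us (of_real x) = 0\<close> \<open>cmod us < \<rho>\<close>] by (auto simp: f_def)
    have fneg: "f u = of_real (Re (f u)) \<and> Re (f u) \<le> 0" if u: "u \<in> Z" for u
    proof -
      have "eval2 H u (of_real x) = 0" "cmod u < \<rho>" using u by (auto simp: Z_def)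
      from res[OF this] obtain h' where "h' > 0" "f u = - of_real ((1 + (Re (u * of_real x))\<^sup>2) / (h' * x ^ (2 * J)))"
        by (auto simp: f_def)
      thus ?thesis using x by (auto intro!: divide_nonneg_pos)
    qed
    have "poly (slice H (of_real x)) (of_real \<rho>) \<noteq> 0" using circle_bound[of "of_real \<rho>"] \<rho> \<kappa> by auto
    hence "slice H (of_real x) \<noteq> 0" by (metis poly_0)
    hence finZ: "finite Z" unfolding Z_def by (rule finite_subset[OF _ poly_roots_finite, rotated]) auto
    \<comment> \<open>Since all residues are real and nonpositive, no cancellation occurs, and a
      single residue is bounded by the modulus of their sum.\<close>
    have "1 / (h * x ^ (2 * J)) \<le> (1 + (Re (us * of_real x))\<^sup>2) / (h * x ^ (2 * J))"
      using h x by (intro divide_right_mono) auto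
    also have "\<dots> = - Re (f us)" by (simp add: h(3))
    also have "\<dots> \<le> (\<Sum>u\<in>Z. - Re (f u))"
      using us finZ fneg by (intro member_le_sum) auto
    also have "\<dots> = - Re (\<Sum>u\<in>Z. f u)" by (simp add: sum_negf)
    also have "\<dots> \<le> cmod (\<Sum>u\<in>Z. f u)" using abs_Re_le_cmod[of "\<Sum>u\<in>Z. f u"] by linarith
    also have "\<dots> \<le> B * \<rho>" by (rule sum_bound)
    finally have "1 / h \<le> B * \<rho> * x ^ (2 * J)" using h(1) x by (simp add: field_simps)
    hence "2 * real m / h \<le> 2 * real m * (B * \<rho>) * x ^ (2 * J)"
      using mult_left_mono[of "1 / h" "B * \<rho> * x ^ (2 * J)" "2 * real m"] by (simp add: mult_ac)
    hence e1: "eps1 c m n \<zeta> \<le> 2 * real m * (B * \<rho>) * x ^ (2 * J)" using h(2) by simp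
    have "\<tau>2 - \<zeta> = \<tau>2 * (1 - cayley (of_real x))" by (simp add: \<zeta>_def algebra_simps)
    hence t: "cmod (\<tau>2 - \<zeta>) = cmod (1 - cayley (of_real x))" using \<tau>' by (simp add: norm_mult)
    have t1: "x \<le> cmod (\<tau>2 - \<zeta>)" "cmod (\<tau>2 - \<zeta>) \<le> 2 * x"
      unfolding t using cayley_real_near_1[of x] x x1 by auto
    have "x ^ (2 * J) \<le> cmod (\<tau>2 - \<zeta>) ^ (2 * J)" using x t1 by (intro power_mono) auto
    also have "\<dots> = cmod (\<tau>2 - \<zeta>) powr (2 * real J)"
      using x t1 by (subst powr_realpow[symmetric]) auto
    finally have "eps1 c m n \<zeta> \<le> 2 * real m * (B * \<rho>) * cmod (\<tau>2 - \<zeta>) powr (2 * real J)"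
      using e1 B \<rho> by (smt (verit) mult_left_mono mult_nonneg_nonneg of_nat_0_le_iff)
    thus "\<exists>\<zeta>. cmod \<zeta> = 1 \<and> 0 < cmod (snd (\<tau>1, \<tau>2) - \<zeta>) \<and> cmod (snd (\<tau>1, \<tau>2) - \<zeta>) < d \<and>
        eps1 c m n \<zeta> \<le> 2 * real m * (B * \<rho>) * cmod (snd (\<tau>1, \<tau>2) - \<zeta>) powr (2 * real J)"
      using \<zeta> t1 x x1 by (intro exI[of _ \<zeta>]) auto
  qed
qed

end

text \<open>Only imaginary rays with slopes between 1/2 and 2 are needed, and one aperture covers
  them all. Both \<open>a\<close> and \<open>b\<close> are left free so that the estimate survives
  an exchange of the variables.\<close>

lemma BJ_point_expansion:
  assumes "BJ_point \<phi> J \<tau>1 \<tau>2"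
  obtains R C \<delta> where "\<delta> > 0"
    "\<And>a b s. 1 \<le> a \<Longrightarrow> a \<le> 2 \<Longrightarrow> 1 \<le> b \<Longrightarrow> b \<le> 2 \<Longrightarrow> 0 < s \<Longrightarrow> s < \<delta> \<Longrightarrow>
      cmod (gfun \<phi> \<tau>1 \<tau>2 (\<i> * of_real (a * s)) (\<i> * of_real (b * s))
        - eval2 R (\<i> * of_real (a * s)) (\<i> * of_real (b * s))) \<le> C * s ^ (2 * J - 1)"
proof -
  obtain \<rho> :: "nat \<times> nat \<Rightarrow> real" where
    "\<forall>c>0. \<exists>C \<delta>. \<delta> > 0 \<and> (\<forall>w1 w2. Im w1 > 0 \<and> Im w2 > 0 \<and> norm (w1, w2) < \<delta> \<and>
          norm (1 / w1, 1 / w2) \<le> c * min (- Im (1 / w1)) (- Im (1 / w2)) \<longrightarrow>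
          cmod (gfun \<phi> \<tau>1 \<tau>2 w1 w2 -
                (\<Sum>(j1, j2)\<in>{(a, b). a + b \<le> 2 * J - 2}. of_real (\<rho> (j1, j2)) * w1 ^ j1 * w2 ^ j2))
            \<le> C * norm (w1, w2) ^ (2 * J - 1))"
    using assms unfolding BJ_point_def by blast
  \<comment> \<open>On these rays the norm of the reciprocals is at most \<open>2 / s\<close>, while
    each \<open>- Im (1 / w)\<close> is at least \<open>1 / (2 * s)\<close>. Their ratio is at most
    4.\<close>
  from this[rule_format, of 4] obtain C \<delta> where \<delta>: "\<delta> > 0" and
    C: "\<And>w1 w2. Im w1 > 0 \<Longrightarrow> Im w2 > 0 \<Longrightarrow> norm (w1, w2) < \<delta> \<Longrightarrow>
          norm (1 / w1, 1 / w2) \<le> 4 * min (- Im (1 / w1)) (- Im (1 / w2)) \<Longrightarrow>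
          cmod (gfun \<phi> \<tau>1 \<tau>2 w1 w2 -
                (\<Sum>(j1, j2)\<in>{(a, b). a + b \<le> 2 * J - 2}. of_real (\<rho> (j1, j2)) * w1 ^ j1 * w2 ^ j2))
            \<le> C * norm (w1, w2) ^ (2 * J - 1)" by auto
  define R where "R = (\<Sum>(j1, j2)\<in>{(a, b). a + b \<le> 2 * J - 2}. monom (monom (complex_of_real (\<rho> (j1, j2))) j2) j1)"
  have R: "eval2 R w1 w2 = (\<Sum>(j1, j2)\<in>{(a, b). a + b \<le> 2 * J - 2}. of_real (\<rho> (j1, j2)) * w1 ^ j1 * w2 ^ j2)" for w1 w2
    unfolding R_def eval2_simps by (intro sum.cong) (auto simp: poly_monom mult_ac)
  show ?thesis
  \<comment> \<open>The norm of \<open>(w1, w2)\<close> is at most \<open>4 * s\<close>, which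
    explains \<open>\<delta> / 4\<close> and the power of 4; the absolute value covers a negative
    \<open>C\<close>.\<close>
  proof (rule that[of "\<delta> / 4" R "\<bar>C\<bar> * 4 ^ (2 * J - 1)"])
    fix a b s :: real assume ab: "1 \<le> a" "a \<le> 2" "1 \<le> b" "b \<le> 2" and s: "0 < s" "s < \<delta> / 4"
    let ?w1 = "\<i> * complex_of_real (a * s)" and ?w2 = "\<i> * complex_of_real (b * s)"
    have n1: "cmod ?w1 = a * s" "cmod ?w2 = b * s" using ab s by (simp_all add: norm_mult)
    have "norm (?w1, ?w2) \<le> a * s + b * s" using norm_Pair_le[of ?w1 ?w2] n1 by simp
    also have "\<dots> \<le> 2 * s + 2 * s" using ab s by (intro add_mono mult_right_mono) auto
    finally have n: "norm (?w1, ?w2) \<le> 4 * s" by simp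
    have inv: "1 / ?w1 = - \<i> * of_real (1 / (a * s))" "1 / ?w2 = - \<i> * of_real (1 / (b * s))"
      using ab s by (simp_all add: field_simps)
    have "norm (1 / ?w1, 1 / ?w2) \<le> cmod (1 / ?w1) + cmod (1 / ?w2)" by (rule norm_Pair_le)
    also have "\<dots> = 1 / (a * s) + 1 / (b * s)"
      unfolding inv norm_mult norm_of_real using ab s by simp
    also have "\<dots> \<le> 1 / s + 1 / s" using ab s by (intro add_mono divide_left_mono) auto
    also have "\<dots> = 4 * (1 / (2 * s))" by simp
    also have "\<dots> \<le> 4 * min (1 / (a * s)) (1 / (b * s))"
      using ab s by (intro mult_left_mono min.boundedI divide_left_mono mult_right_mono) auto
    also have "\<dots> = 4 * min (- Im (1 / ?w1)) (- Im (1 / ?w2))" unfolding inv by simp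
    finally have "cmod (gfun \<phi> \<tau>1 \<tau>2 ?w1 ?w2 - eval2 R ?w1 ?w2) \<le> C * norm (?w1, ?w2) ^ (2 * J - 1)"
      unfolding R using n ab s by (intro C) auto
    also have "\<dots> \<le> \<bar>C\<bar> * (4 * s) ^ (2 * J - 1)"
      using n s by (intro mult_mono power_mono) auto
    finally show "cmod (gfun \<phi> \<tau>1 \<tau>2 ?w1 ?w2 - eval2 R ?w1 ?w2) \<le> \<bar>C\<bar> * 4 ^ (2 * J - 1) * s ^ (2 * J - 1)"
      by (simp add: power_mult_distrib mult_ac)
  qed (use \<delta> in simp)
qed

section \<open>Interchanging the variables\<close>

lemma sing_swap: "(z, w) \<in> sing (\<lambda>j i. c i j) n m \<longleftrightarrow> (w, z) \<in> sing c m n"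
  by (auto simp: sing_def bipoly_swap[of c])

lemma is_poly2_swap: "is_poly2 (\<lambda>z w. f w z) \<longleftrightarrow> is_poly2 f"
proof -
  have "is_poly2 (\<lambda>z w. f w z)" if f: "is_poly2 f" for f
  proof -
    obtain N d where d: "\<forall>z w. f z w = (\<Sum>i\<le>N. \<Sum>j\<le>N. d i j * z ^ i * w ^ j)"
      using f unfolding is_poly2_def by blast
    have "\<forall>z w. f w z = (\<Sum>i\<le>N. \<Sum>j\<le>N. d j i * z ^ i * w ^ j)"
      unfolding d[rule_format] by (subst sum.swap) (simp add: mult_ac)
    thus ?thesis unfolding is_poly2_def by (intro exI[of _ N] exI[of _ "\<lambda>i j. d j i"])
  qed
  from this[of f] this[of "\<lambda>z w. f w z"] show ?thesis by auto
qed

lemma atoral_swap: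
  assumes "atoral c m n"
  shows "atoral (\<lambda>j i. c i j) n m"
  unfolding atoral_def
proof safe
  fix q r s assume *: "is_poly2 q" "is_poly2 r" "is_poly2 s" "\<nexists>k. \<forall>z w. q z w = k"
    "\<forall>z w. bipoly (\<lambda>j i. c i j) n m z w = q z w * r z w"
    "\<forall>z w. refl_bipoly (\<lambda>j i. c i j) n m z w = q z w * s z w"
  have "\<not> atoral c m n"
    unfolding atoral_def not_not
  proof (intro exI conjI)
    show "is_poly2 (\<lambda>z w. q w z)" "is_poly2 (\<lambda>z w. r w z)" "is_poly2 (\<lambda>z w. s w z)"
      using *(1-3) is_poly2_swap by blast+
    show "\<nexists>k. \<forall>z w. q w z = k" using *(4) by blast
    show "\<forall>z w. bipoly c m n z w = q w z * r w z" "\<forall>z w. refl_bipoly c m n z w = q w z * s w z"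
      using *(5,6) by (simp_all add: bipoly_swap[of c] refl_bipoly_swap[of c])
  qed
  thus False using assms by simp
qed

lemma K2_eq_K1_swap: "K2 c m n = K1 (\<lambda>j i. c i j) n m"
proof -
  have img: "snd ` sing (\<lambda>j i. c i j) n m = fst ` sing c m n"
    unfolding snd_eq_Range fst_eq_Domain set_eq_iff Range_iff Domain_iff sing_swap[of _ _ c] by simp
  have eps: "eps1 (\<lambda>j i. c i j) n m = eps2 c m n"
    by (simp add: fun_eq_iff eps1_def eps2_def img refl_bipoly_swap[of c])
  have "(\<exists>\<sigma>\<in>sing c m n. contact_exp (eps2 c m n) (fst \<sigma>) K)
      \<longleftrightarrow> (\<exists>\<sigma>\<in>sing (\<lambda>j i. c i j) n m. contact_exp (eps2 c m n) (snd \<sigma>) K)" for K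
  proof -
    have "(\<exists>x\<in>fst ` sing c m n. contact_exp (eps2 c m n) x K)
      \<longleftrightarrow> (\<exists>x\<in>snd ` sing (\<lambda>j i. c i j) n m. contact_exp (eps2 c m n) x K)" unfolding img ..
    thus ?thesis by simp
  qed
  thus ?thesis unfolding K1_def K2_def eps by simp
qed

lemma hsum_swap: "eval2 (hsum (\<lambda>j i. c i j) n m t2 t1) w2 w1 = eval2 (hsum c m n t1 t2) w1 w2"
proof -
  have "refl_coeffs (\<lambda>j i. c i j) n m = (\<lambda>j i. refl_coeffs c m n i j)"
    by (simp add: fun_eq_iff refl_coeffs_def)
  thus ?thesis by (simp add: hsum_def eval2_halfplane_poly_swap[of c] eval2_halfplane_poly_swap[of "refl_coeffs c m n"])
qed

theorem theorem7p1:
  fixes c :: "nat \<Rightarrow> nat \<Rightarrow> complex" and m n J :: nat and \<tau>1 \<tau>2 :: complex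
  assumes "has_bidegree c m n"
    and "\<forall>z1 z2. cmod z1 < 1 \<and> cmod z2 < 1 \<longrightarrow> bipoly c m n z1 z2 \<noteq> 0"
    and "atoral c m n"
    and "(\<tau>1, \<tau>2) \<in> sing c m n"
    and "J > 0"
    and "BJ_point (rif c m n) J \<tau>1 \<tau>2"
  shows "max (K1 c m n) (K2 c m n) \<ge> 2 * real J"
proof -
  define c' where "c' = (\<lambda>j i. c i j)"
  have sing': "(\<tau>2, \<tau>1) \<in> sing c' n m" using assms(4) unfolding c'_def by (simp add: sing_swap[of _ _ c])
  interpret o: stable_atoral c m n
    by unfold_locales (use assms(2-4) in auto)
  interpret s: stable_atoral c' n m
  proof unfold_locales
    show "bipoly c' n m z w \<noteq> 0" if "cmod z < 1" "cmod w < 1" for z w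
      using assms(2) that unfolding c'_def bipoly_swap[of c] by blast
    show "atoral c' n m" unfolding c'_def by (rule atoral_swap[OF assms(3)])
    show "sing c' n m \<noteq> {}" using sing' by auto
  qed
  have \<tau>: "cmod \<tau>1 = 1" "cmod \<tau>2 = 1" "bipoly c m n \<tau>1 \<tau>2 = 0"
    using assms(4) by (auto simp: sing_def)
  obtain R C \<delta> where \<delta>: "\<delta> > 0" and expansion:
    "\<And>a b s. 1 \<le> a \<Longrightarrow> a \<le> 2 \<Longrightarrow> 1 \<le> b \<Longrightarrow> b \<le> 2 \<Longrightarrow> 0 < s \<Longrightarrow> s < \<delta> \<Longrightarrow>
      cmod (gfun (rif c m n) \<tau>1 \<tau>2 (\<i> * of_real (a * s)) (\<i> * of_real (b * s))
        - eval2 R (\<i> * of_real (a * s)) (\<i> * of_real (b * s))) \<le> C * s ^ (2 * J - 1)"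
    using BJ_point_expansion[OF assms(6)] by metis
  obtain R' where R': "\<And>z w. eval2 R' z w = eval2 R w z"
  proof -
    have "is_poly2 (\<lambda>z w. eval2 R w z)" unfolding is_poly2_swap[of "eval2 R"] by (auto simp: is_poly2_iff)
    thus ?thesis using that unfolding is_poly2_iff by metis
  qed
  have gfun': "gfun (rif c' n m) \<tau>2 \<tau>1 w2 w1 = gfun (rif c m n) \<tau>1 \<tau>2 w1 w2" for w1 w2
    by (simp add: gfun_def rif_def c'_def bipoly_swap[of c] refl_bipoly_swap[of c])
  obtain M H where H: "\<And>u x. eval2 (hsum c m n \<tau>1 \<tau>2) (u * x) x = x ^ M * eval2 H u x" "slice H 0 \<noteq> 0"
    using blow_up[OF o.hsum_nonzero[OF \<tau>(2)]] by metis
  obtain M' H' where H': "\<And>u x. eval2 (hsum c' n m \<tau>2 \<tau>1) (u * x) x = x ^ M' * eval2 H' u x" "slice H' 0 \<noteq> 0"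
    using blow_up[OF s.hsum_nonzero[OF \<tau>(1)]] by metis
  have "eval2 (hsum c m n \<tau>1 \<tau>2) 0 0 = 0"
    using eval2_hsum_hdiff(1)[of 0 0 c m n \<tau>1 \<tau>2] \<tau>(3) refl_bipoly_eq_0_on_torus[OF \<tau>]
    by (simp add: cayley_def)
  moreover have "eval2 (hsum c' n m \<tau>2 \<tau>1) x y = eval2 (hsum c m n \<tau>1 \<tau>2) y x" for x y
    unfolding c'_def by (rule hsum_swap)
  \<comment> \<open>The lowest homogeneous part is not a power of the second variable, or, after the
    exchange, not a power of the first. The two cases bound \<open>K1\<close> and \<open>K2\<close>
    respectively.\<close>
  ultimately have "degree (slice H 0) > 0 \<or> degree (slice H' 0) > 0"
    by (intro blow_up_nonconstant_one_way[OF H H'])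
  thus ?thesis
  proof
    assume "degree (slice H 0) > 0"
    hence "K1 c m n \<ge> 2 * real J"
      using o.K1_ge_of_expansion[OF assms(4,5) \<delta> expansion H] by blast
    thus ?thesis by simp
  next
    assume "degree (slice H' 0) > 0"
    moreover have "cmod (gfun (rif c' n m) \<tau>2 \<tau>1 (\<i> * of_real (a * s)) (\<i> * of_real (b * s))
        - eval2 R' (\<i> * of_real (a * s)) (\<i> * of_real (b * s))) \<le> C * s ^ (2 * J - 1)"
      if "1 \<le> a" "a \<le> 2" "1 \<le> b" "b \<le> 2" "0 < s" "s < \<delta>" for a b s
      unfolding gfun' R' by (rule expansion) (use that in auto)
    ultimately have "K1 c' n m \<ge> 2 * real J"
      using s.K1_ge_of_expansion[OF sing' assms(5) \<delta> _ H'] by blast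
    thus ?thesis by (simp add: K2_eq_K1_swap[of c] c'_def)
  qed
qed

end
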